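(* Let $f:\mathbb{R}^{n}\to\mathbb{R}_{\infty}$ be a proper lower semi-continuous function, quadratically minorised and prox-regular at $\bar{x}$ for $\bar z=0\in\partial f(\bar{x})$. Suppose that $\mathcal{U}^{2}:=\operatorname{dom}q(\underline{\partial}^{2}f(\bar{x},0))(\cdot)$ satisfies $\mathcal{U}^{2}=\mathcal{U}$ and is a linear subspace, that $f$ has a tilt stable local minimum at $\bar{x}$ for $0\in\operatorname{rel-int}\partial f(\bar x)$, and that $\partial^{\infty}f(\bar{x}+u+v(u))=\{0\}$ for $v(u)\in\operatorname{argmin}_{v'\in\mathcal{V}\cap B_{\varepsilon}(0)}\{g(u+v')\}:\mathcal{U}\to\mathcal{V}$, $u\in B_{\varepsilon}^{\mathcal{U}}(0)$, where $g:=\operatorname{co}h$. Suppose moreover that there is a $\rho>0$ (with $\rho\le\varepsilon$) such that for all $z_{\mathcal{V}}\in B_{\rho}(0)\cap\mathcal{V}\subseteq\partial_{\mathcal{V}}f(\bar{x})$ we have a common $$\{v(u)\}=\operatorname{argmin}_{v\in\mathcal{V}\cap B_{\varepsilon}(0)}\{f(\bar{x}+u+v)-\langle z_{\mathcal{V}},v\rangle\}\quad\text{for all }u\in B_{\varepsilon}(0)\cap\mathcal{U}.$$ Then the following local lower Taylor estimate holds: there exists $\delta>0$ such that for all $u\in B_{\delta}(0)\cap\mathcal{U}$ we have, for all $u'+v'\in B_{\delta}(u+v(u))$ (with $u'\in\mathcal U$, $v'\in\mathcal V$), $$f(\bar{x}+u'+v')\ \ge\ f(\bar{x}+u+v(u))+\langle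 z_{\mathcal{U}}(u)+\bar{z}_{\mathcal{V}},\,u'+v'-(u+v(u))\rangle+\tfrac12(u'-u)^{T}Q(u'-u)+o(\|u'-u\|^{2})$$ for all $Q\in\partial^{2,-}L_{\mathcal{U}}^{\varepsilon}(u,z_{\mathcal{U}}(u))$, where $z_{\mathcal{U}}(u):=\nabla L_{\mathcal{U}}^{\varepsilon}(u)$.
   Context: Notation: $\mathbb{R}_{\infty}=\mathbb{R}\cup\{+\infty\}$; balls are closed, and for a subspace $X$, $B_{\varepsilon}^{X}(0)=X\cap B_{\varepsilon}(0)$; $\delta_{C}$ is the indicator function of $C$ ($0$ on $C$, $+\infty$ off $C$); $\operatorname{co}h$ is the function whose epigraph is the closed convex hull of $\operatorname{epi}h$. Here $\varepsilon>0$ is the radius of localisation and $h(w):=f(\bar x+w)+\delta_{B^{\mathcal U}_\varepsilon(0)\oplus B^{\mathcal V}_\varepsilon(0)}(w)$. $x'\to_{f}x$ means $x'\to x$ and $f(x')\to f(x)$. $\mathcal{S}(n)$: symmetric $n\times n$ matrices. Localised $\mathcal U$-Lagrangian: $L_{\mathcal U}^{\varepsilon}(u):=\inf_{v'\in\mathcal V\cap B_\varepsilon(0)}\{f(\bar x+u+v')-\langle \bar z_{\mathcal V},v'\rangle\}$ for $u\in B^{\mathcal U}_\varepsilon(0)$ and $+\infty$ otherwise on $\mathcal U$, where $\bar z_{\mathcal V}$ is the $\mathcal V$-component of $\bar z$ (here $\bar z=0$, so $\bar z_{\mathcal V}=0$). Proximal subdifferential: $z\in\partial_{p}f(x)$ iff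 for some $r\ge 0$, $f(x')\ge f(x)+\langle z,x'-x\rangle-\frac r2\|x'-x\|^{2}$ for all $x'$ near $x$. Limiting subdifferential: $\partial f(x)=\{z\mid\exists x_{k}\to_{f}x,\ z_{k}\in\partial_{p}f(x_{k}),\ z_{k}\to z\}$. Singular limiting subdifferential: $\partial^{\infty}f(x)=\{z\mid\exists x_{k}\to_{f}x,\ z_{k}\in\partial_{p}f(x_{k}),\ \lambda_{k}\downarrow0,\ \lambda_{k}z_{k}\to z\}$. $\operatorname{rel-int}$ is the interior relative to the affine hull. $f$ is quadratically minorised if there is a quadratic function $\alpha-\frac R2\|x-\bar x\|^{2}$ lying below $f$ globally. $f$ is prox-regular at $\bar x$ for $\bar z\in\partial f(\bar x)$ if $f$ is finite and locally lower semi-continuous at $\bar x$, and for some $\varepsilon>0,r\ge 0$: $f(x')\ge f(x)+\langle z,x'-x\rangle-\frac r2\|x'-x\|^{2}$ whenever $\|x'-\bar x\|\le\varepsilon$, $\|x-\bar x\|\le\varepsilon$, $|f(x)-f(\bar x)|\le\varepsilon$, $\|z-\bar z\|\le\varepsilon$, $z\in\partial f(x)$. $\bar x$ gives a tilt stable local minimum of $f$ if $f(\bar x)$ is finite and for some $\varepsilon>0$ the mapping $z\mapsto\operatorname{argmin}_{\|x-\bar x\|\le\varepsilon}\{f(x)-\langle x,z\rangle\}$ is single valued and Lipschitz on a neighbourhood of $0$ with value $\bar x$ at $z=0$. Subjet of a function $\phi$: $\partial^{2,-}\phi(x)=\{(\nabla\varphi(x),\nabla^{2}\varphi(x))\mid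 \varphi\in C^{2},\ \phi-\varphi\text{ has a local minimum at }x\}$, and subhessians $\partial^{2,-}\phi(x,z)=\{Q\mid(z,Q)\in\partial^{2,-}\phi(x)\}$ (for $L^\varepsilon_{\mathcal U}$ these are taken in the space $\mathcal U$). $\underline{\partial}^{2}f(x)$ is the set of limits of $(z_{k},Q_{k})\in\partial^{2,-}f(x_{k})$ with $x_{k}\to_{f}x$; $\underline{\partial}^{2}f(x,z)=\{Q\in\mathcal{S}(n)\mid(z,Q)\in\underline{\partial}^{2}f(x)\}$; $q(\mathcal{A})(h)=\sup\{\langle Qh,h\rangle\mid Q\in\mathcal{A}\}$ and $\operatorname{dom}q(\mathcal A)(\cdot)=\{h\mid q(\mathcal{A})(h)<\infty\}$. $\mathcal{VU}$-decomposition (here $\bar z=0$): $\mathcal{V}:=\operatorname{span}\{\partial f(\bar x)-\bar z\}$, $\mathcal{U}:=\mathcal{V}^{\perp}$; $\partial_{\mathcal{V}}f(\bar x):=P_{\mathcal{V}}(\partial f(\bar x))$ with $P_{\mathcal{V}}$ the orthogonal projection onto $\mathcal V$.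
   Formalization: Tilt stability is assumed on the ball of the localisation radius ε itself, not on some unrelated ball; otherwise the claim fails, e.g. f(u,v)=min(|v|+u², −1+|v−5|−|u|) at 0 with ε=10, where L_U(u)=−1−|u| has no gradient at 0. *)

theory Defs
  imports "HOL-Analysis.Analysis" "HOL-Library.Landau_Symbols"
begin

definition proper_fun :: "('a \<Rightarrow> ereal) \<Rightarrow> bool" where
  "proper_fun f \<longleftrightarrow> (\<forall>x. f x \<noteq> -\<infinity>) \<and> (\<exists>x. f x \<noteq> \<infinity>)"

definition lsc_fun :: "('a::topological_space \<Rightarrow> ereal) \<Rightarrow> bool" where
  "lsc_fun f \<longleftrightarrow> (\<forall>x. f x \<le> Liminf (nhds x) f)"

text \<open>Local lower semicontinuity in the sense of Rockafellar and Wets (Variational Analysis,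
  Definition 1.33).\<close>

definition locally_lsc_at :: "('a::metric_space \<Rightarrow> ereal) \<Rightarrow> 'a \<Rightarrow> bool" where
  "locally_lsc_at f x \<longleftrightarrow>
     (\<exists>e>0. \<forall>a::real. ereal a \<le> f x + ereal e \<longrightarrow> closed {y \<in> cball x e. f y \<le> ereal a})"

definition quadratically_minorised :: "('a::real_normed_vector \<Rightarrow> ereal) \<Rightarrow> 'a \<Rightarrow> bool" where
  "quadratically_minorised f xbar \<longleftrightarrow>
     (\<exists>\<alpha> R::real. \<forall>x. f x \<ge> ereal (\<alpha> - R / 2 * (norm (x - xbar))\<^sup>2))"

definition indicator_fun :: "'a set \<Rightarrow> 'a \<Rightarrow> ereal" where
  "indicator_fun C x = (if x \<in> C then 0 else \<infinity>)"

text \<open>If \<open>\<phi>\<close> is identically \<open>\<infinity>\<close> on \<open>C\<close>, every point of \<open>C\<close> is a minimiser.\<close>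

definition argmin_on :: "('a \<Rightarrow> ereal) \<Rightarrow> 'a set \<Rightarrow> 'a set" where
  "argmin_on \<phi> C = {x. is_arg_min \<phi> (\<lambda>y. y \<in> C) x}"

definition epi :: "('a \<Rightarrow> ereal) \<Rightarrow> ('a \<times> real) set" where
  "epi h = {(x, t). h x \<le> ereal t}"

text \<open>The pointwise infimum over the closed convex hull of the epigraph; lemma \<open>epi_co\<close> shows
  that this hull is again an epigraph, namely that of \<open>co h\<close>.\<close>

definition co :: "('a::real_normed_vector \<Rightarrow> ereal) \<Rightarrow> 'a \<Rightarrow> ereal" where
  "co h x = (INF t \<in> {t. (x, t) \<in> closure (convex hull (epi h))}. ereal t)"

lemma epi_co: "epi (co h) = closure (convex hull (epi h))"
proof -
  let ?K = "closure (convex hull (epi h))"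
  have up: "(x, t + c) \<in> ?K" if "(x, t) \<in> ?K" "c \<ge> 0" for x t c
  proof -
    have "(+) (0, c) ` epi h \<subseteq> epi h"
    proof
      fix p assume "p \<in> (+) (0, c) ` epi h"
      then obtain y s where p: "p = (y, c + s)" and "h y \<le> ereal s"
        by (auto simp: epi_def)
      moreover have "ereal s \<le> ereal (c + s)" using that(2) by simp
      ultimately have "h y \<le> ereal (c + s)" using order_trans by blast
      then show "p \<in> epi h" using p by (simp add: epi_def)
    qed
    then have "(+) (0, c) ` (convex hull (epi h)) \<subseteq> convex hull (epi h)"
      by (metis convex_hull_translation hull_mono)
    then have "(+) (0, c) ` ?K \<subseteq> ?K"
      by (metis closure_mono closure_translation)
    then have "(0, c) + (x, t) \<in> ?K" using that(1) by blast
    then show ?thesis by (simp add: add.commute)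
  qed
  have "(x, s) \<in> ?K" if le: "co h x \<le> ereal s" for x s
  proof -
    have mem: "(x, s + inverse (real (Suc n))) \<in> ?K" for n
    proof -
      have "co h x < ereal (s + inverse (real (Suc n)))"
        using le by (rule order.strict_trans1) simp
      then obtain t where "(x, t) \<in> ?K" "t < s + inverse (real (Suc n))"
        unfolding co_def by (auto simp: INF_less_iff)
      then show ?thesis
        using up[of x t "s + inverse (real (Suc n)) - t"] by simp
    qed
    have "(\<lambda>n. (x, s + inverse (real (Suc n)))) \<longlonglongrightarrow> (x, s + 0)"
      by (intro tendsto_intros LIMSEQ_inverse_real_of_nat)
    then have "(x, s + 0) \<in> ?K"
      by (intro closed_sequentially[OF closed_closure mem])
    then show ?thesis by simp
  qed
  moreover have "co h x \<le> ereal s" if "(x, s) \<in> ?K" for x s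
    unfolding co_def using that by (intro INF_lower) simp
  ultimately show ?thesis by (auto simp: epi_def)
qed

text \<open>By convention the proximal subdifferential is empty at points where \<open>f\<close> is infinite.\<close>

definition prox_subdiff :: "('a::real_inner \<Rightarrow> ereal) \<Rightarrow> 'a \<Rightarrow> 'a set" where
  "prox_subdiff f x = {z. \<bar>f x\<bar> \<noteq> \<infinity> \<and> (\<exists>r\<ge>0. \<forall>\<^sub>F y in nhds x.
      f y \<ge> f x + ereal (z \<bullet> (y - x) - r / 2 * (norm (y - x))\<^sup>2))}"

definition converges_wrt :: "('a::topological_space \<Rightarrow> ereal) \<Rightarrow> (nat \<Rightarrow> 'a) \<Rightarrow> 'a \<Rightarrow> bool" where
  "converges_wrt f xs x \<longleftrightarrow> xs \<longlonglongrightarrow> x \<and> (\<lambda>k. f (xs k)) \<longlonglongrightarrow> f x"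

definition lim_subdiff :: "('a::real_inner \<Rightarrow> ereal) \<Rightarrow> 'a \<Rightarrow> 'a set" where
  "lim_subdiff f x = {z. \<exists>xs zs. converges_wrt f xs x \<and>
      (\<forall>k. zs k \<in> prox_subdiff f (xs k)) \<and> zs \<longlonglongrightarrow> z}"

definition sing_subdiff :: "('a::real_inner \<Rightarrow> ereal) \<Rightarrow> 'a \<Rightarrow> 'a set" where
  "sing_subdiff f x = {z. \<exists>xs zs t. converges_wrt f xs x \<and>
      (\<forall>k. zs k \<in> prox_subdiff f (xs k)) \<and>
      (\<forall>k. t k > (0::real)) \<and> decseq t \<and> t \<longlonglongrightarrow> 0 \<and>
      (\<lambda>k. t k *\<^sub>R zs k) \<longlonglongrightarrow> z}"

definition prox_regular :: "('a::real_inner \<Rightarrow> ereal) \<Rightarrow> 'a \<Rightarrow> 'a \<Rightarrow> bool" where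
  "prox_regular f xbar zbar \<longleftrightarrow>
     \<bar>f xbar\<bar> \<noteq> \<infinity> \<and> locally_lsc_at f xbar \<and> zbar \<in> lim_subdiff f xbar \<and>
     (\<exists>e>0. \<exists>r\<ge>0. \<forall>x' x z.
        norm (x' - xbar) \<le> e \<and> norm (x - xbar) \<le> e \<and> \<bar>f x - f xbar\<bar> \<le> ereal e \<and>
        norm (z - zbar) \<le> e \<and> z \<in> lim_subdiff f x \<longrightarrow>
        f x' \<ge> f x + ereal (z \<bullet> (x' - x) - r / 2 * (norm (x' - x))\<^sup>2))"

text \<open>The radius \<open>e\<close> of the ball on which the tilted functions are minimised is a parameter.
  Having this property for some \<open>e > 0\<close> is tilt stability; it is inherited by smaller radii.\<close>

definition tilt_stable_min :: "('a::euclidean_space \<Rightarrow> ereal) \<Rightarrow> 'a \<Rightarrow> real \<Rightarrow> bool" where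
  "tilt_stable_min f xbar e \<longleftrightarrow>
     \<bar>f xbar\<bar> \<noteq> \<infinity> \<and> e > 0 \<and>
     (\<exists>N m K. open N \<and> 0 \<in> N \<and> K-lipschitz_on N m \<and> m 0 = xbar \<and>
        (\<forall>z\<in>N. argmin_on (\<lambda>x. f x - ereal (x \<bullet> z)) (cball xbar e) = {m z}))"

definition has_gradient_on ::
    "'a::euclidean_space set \<Rightarrow> ('a \<Rightarrow> ereal) \<Rightarrow> 'a \<Rightarrow> 'a \<Rightarrow> bool" where
  "has_gradient_on X \<phi> z x \<longleftrightarrow>
     x \<in> X \<and> z \<in> X \<and> \<bar>\<phi> x\<bar> \<noteq> \<infinity> \<and> (\<forall>\<^sub>F y in at x within X. \<bar>\<phi> y\<bar> \<noteq> \<infinity>) \<and>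
     ((\<lambda>y. real_of_ereal (\<phi> y)) has_derivative (\<lambda>h. z \<bullet> h)) (at x within X)"

text \<open>\<open>\<psi>\<close> is a \<open>C\<^sup>2\<close> function on the linear subspace \<open>X\<close> with gradient \<open>G\<close> and Hessian \<open>H\<close>.
  A symmetric operator on \<open>X\<close> is represented by the \<open>n \<times> n\<close> matrix which acts as this
  operator on \<open>X\<close> and as zero on the orthogonal complement of \<open>X\<close>; for \<open>X = UNIV\<close> this is
  the usual Hessian matrix.\<close>

definition C2_on :: "(real^'n) set \<Rightarrow> (real^'n \<Rightarrow> real) \<Rightarrow> (real^'n \<Rightarrow> real^'n) \<Rightarrow>
    (real^'n \<Rightarrow> real^'n^'n) \<Rightarrow> bool" where
  "C2_on X \<psi> G H \<longleftrightarrow>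
     (\<forall>x\<in>X. G x \<in> X \<and> (\<psi> has_derivative (\<lambda>h. G x \<bullet> h)) (at x within X)) \<and>
     (\<forall>x\<in>X. (G has_derivative (\<lambda>h. H x *v h)) (at x within X) \<and> (\<forall>h\<in>X\<^sup>\<bottom>. H x *v h = 0)) \<and>
     continuous_on X H"

definition subjet :: "(real^'n) set \<Rightarrow> (real^'n \<Rightarrow> ereal) \<Rightarrow> real^'n \<Rightarrow>
    ((real^'n) \<times> (real^'n^'n)) set" where
  "subjet X \<phi> x = {(z, Q). x \<in> X \<and> \<bar>\<phi> x\<bar> \<noteq> \<infinity> \<and>
     (\<exists>\<psi> G H. C2_on X \<psi> G H \<and> z = G x \<and> Q = H x \<and>
        (\<forall>\<^sub>F y in at x within X. \<phi> x - ereal (\<psi> x) \<le> \<phi> y - ereal (\<psi> y)))}"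

definition subhess :: "(real^'n) set \<Rightarrow> (real^'n \<Rightarrow> ereal) \<Rightarrow> real^'n \<Rightarrow> real^'n \<Rightarrow>
    (real^'n^'n) set" where
  "subhess X \<phi> x z = {Q. (z, Q) \<in> subjet X \<phi> x}"

definition lim_subjet :: "(real^'n \<Rightarrow> ereal) \<Rightarrow> real^'n \<Rightarrow>
    ((real^'n) \<times> (real^'n^'n)) set" where
  "lim_subjet f x = {(z, Q). \<exists>xs zs Qs. converges_wrt f xs x \<and>
     (\<forall>k. (zs k, Qs k) \<in> subjet UNIV f (xs k)) \<and> zs \<longlonglongrightarrow> z \<and> Qs \<longlonglongrightarrow> Q}"

definition lim_subhess :: "(real^'n \<Rightarrow> ereal) \<Rightarrow> real^'n \<Rightarrow> real^'n \<Rightarrow> (real^'n^'n) set" where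
  "lim_subhess f x z = {Q. transpose Q = Q \<and> (z, Q) \<in> lim_subjet f x}"

text \<open>The function \<open>q(A)(h)\<close>, with value \<open>-\<infinity>\<close> for empty \<open>A\<close>.\<close>

definition rank1_support :: "(real^'n^'n) set \<Rightarrow> real^'n \<Rightarrow> ereal" where
  "rank1_support A h = (SUP Q\<in>A. ereal ((Q *v h) \<bullet> h))"

definition dom_rank1_support :: "(real^'n^'n) set \<Rightarrow> (real^'n) set" where
  "dom_rank1_support A = {h. rank1_support A h < \<infinity>}"

definition orth_proj :: "'a::euclidean_space set \<Rightarrow> 'a \<Rightarrow> 'a" where
  "orth_proj S x = (THE y. y \<in> S \<and> x - y \<in> S\<^sup>\<bottom>)"

definition V_space :: "('a::euclidean_space \<Rightarrow> ereal) \<Rightarrow> 'a \<Rightarrow> 'a \<Rightarrow> 'a set" where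
  "V_space f xbar zbar = span ((\<lambda>z. z - zbar) ` lim_subdiff f xbar)"

definition U_space :: "('a::euclidean_space \<Rightarrow> ereal) \<Rightarrow> 'a \<Rightarrow> 'a \<Rightarrow> 'a set" where
  "U_space f xbar zbar = (V_space f xbar zbar)\<^sup>\<bottom>"

definition V_subdiff :: "('a::euclidean_space \<Rightarrow> ereal) \<Rightarrow> 'a \<Rightarrow> 'a \<Rightarrow> 'a set" where
  "V_subdiff f xbar zbar = orth_proj (V_space f xbar zbar) ` lim_subdiff f xbar"

definition localised :: "('a::euclidean_space \<Rightarrow> ereal) \<Rightarrow> 'a \<Rightarrow> 'a \<Rightarrow> real \<Rightarrow> 'a \<Rightarrow> ereal" where
  "localised f xbar zbar e w =
     f (xbar + w) +
     indicator_fun {u + v | u v. u \<in> U_space f xbar zbar \<inter> cball 0 e \<and>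
                                v \<in> V_space f xbar zbar \<inter> cball 0 e} w"

definition U_Lagrangian :: "('a::euclidean_space \<Rightarrow> ereal) \<Rightarrow> 'a \<Rightarrow> 'a \<Rightarrow> real \<Rightarrow> 'a \<Rightarrow> ereal" where
  "U_Lagrangian f xbar zbar e u =
     (if u \<in> U_space f xbar zbar \<inter> cball 0 e
      then (INF v \<in> V_space f xbar zbar \<inter> cball 0 e.
              f (xbar + u + v) - ereal (orth_proj (V_space f xbar zbar) zbar \<bullet> v))
      else \<infinity>)"

end

theory Submission
  imports Defs
begin

text \<open>
  Write \<open>l(u) = f(xbar + u + v(u))\<close>, which is the \<open>U\<close>-Lagrangian since \<open>zbar = 0\<close>. By tilt
  stability the minimisers \<open>m(z)\<close> of \<open>f - z\<close> on the ball depend continuously on \<open>z\<close>, and the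
  \<open>U\<close>-components of \<open>m(z)\<close> with small \<open>z\<close> in \<open>U\<close> fill a neighbourhood of \<open>0\<close> in \<open>U\<close>: for
  given \<open>u\<close>, take the maximiser \<open>z\<close> of the concave function \<open>z \<mapsto> z \<bullet> u - \<phi>(z)\<close>, where \<open>\<phi>\<close> is the
  conjugate of \<open>f\<close>, whose gradient is \<open>m\<close>. This maximiser is interior because \<open>\<phi>\<close>, restricted
  to \<open>U\<close>, has a strict minimum at \<open>0\<close>, all subgradients of \<open>f\<close> at \<open>xbar\<close> lying in \<open>V\<close>. Since
  minimisers along \<open>V\<close> are unique and \<open>v(u) \<rightarrow> 0\<close> as \<open>u \<rightarrow> 0\<close>, it follows that \<open>m(z) = u + v(u)\<close>,
  and hence \<open>l\<close> has a subgradient \<open>z\<close> at every \<open>u\<close> near \<open>0\<close>.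

  If \<open>l\<close> had two subgradients at points \<open>u\<close> arbitrarily close to \<open>0\<close>, then \<open>f\<close> would have a kink at
  \<open>xbar + u + v(u)\<close> in some unit direction \<open>h\<close> of \<open>U\<close>, so that \<open>K h h\<^sup>T\<close> would be a subhessian
  there for every \<open>K\<close>. In the limit this contradicts the finiteness of \<open>q\<close> on \<open>U\<close>. So the
  subgradient is unique near \<open>0\<close>, \<open>l\<close> is differentiable there, and the lower Taylor estimate is
  that of \<open>l\<close>, because \<open>f(xbar + u' + v') \<ge> l(u')\<close>.
\<close>

section \<open>Surjectivity of the map from tilts to minimisers\<close>

text \<open>The function \<phi> below is the conjugate of \<open>p\<close> along \<open>m\<close>,
  and \<open>m z\<close> is a subgradient of it at \<open>z\<close>. Maximising
  \<open>z \<bullet> u - \<phi> z\<close> over \<open>U \<inter> cball 0 \<eta>\<close> gives a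
  \<open>z\<close> at which the first-order condition reads: \<open>m z - u\<close> is orthogonal to
  \<open>U\<close>. What must be excluded is a maximiser on the sphere.\<close>

lemma tilt_argmin_onto:
  fixes U :: "'a::euclidean_space set" and m :: "'a \<Rightarrow> 'a" and p :: "'a \<Rightarrow> real"
  assumes "subspace U" "\<eta> > 0" and cont: "continuous_on (cball 0 \<eta>) m" and m0: "m 0 = 0"
    and ineq: "\<And>z z'. z \<in> cball 0 \<eta> \<Longrightarrow> z' \<in> cball 0 \<eta> \<Longrightarrow> p z + z \<bullet> (m z' - m z) \<le> p z'"
    and only0: "\<And>z. z \<in> U \<Longrightarrow> z \<in> cball 0 \<eta> \<Longrightarrow> p 0 = p z - z \<bullet> m z \<Longrightarrow> z = 0"
  obtains \<delta> where "\<delta> > 0"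
    "\<And>u. u \<in> U \<Longrightarrow> norm u \<le> \<delta> \<Longrightarrow> \<exists>z\<in>U. norm z \<le> \<eta> \<and> m z - u \<in> U\<^sup>\<bottom>"
proof -
  define \<phi> where "\<phi> z = z \<bullet> m z - p z" for z
  have \<phi>: "\<phi> z + (z' - z) \<bullet> m z \<le> \<phi> z'" if "z \<in> cball 0 \<eta>" "z' \<in> cball 0 \<eta>" for z z'
    using ineq[OF that(2) that(1)] by (simp add: \<phi>_def inner_diff_left inner_diff_right)
  have "bounded (m ` cball 0 \<eta>)"
    by (intro compact_imp_bounded compact_continuous_image cont compact_cball)
  then obtain B where B: "B > 0" "\<And>z. z \<in> cball 0 \<eta> \<Longrightarrow> norm (m z) \<le> B"
    by (auto simp: bounded_pos)
  have le: "\<phi> z - \<phi> z' \<le> B * dist z z'" if "z \<in> cball 0 \<eta>" "z' \<in> cball 0 \<eta>" for z z'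
  proof -
    have "\<phi> z - \<phi> z' \<le> (z - z') \<bullet> m z"
      using \<phi>[OF that] by (simp add: inner_diff_left)
    also have "\<dots> \<le> norm (z - z') * norm (m z)" by (rule norm_cauchy_schwarz)
    also have "\<dots> \<le> B * dist z z'"
      using B(2)[OF that(1)] by (simp add: dist_norm mult.commute[of B] mult_left_mono)
    finally show ?thesis .
  qed
  have "B-lipschitz_on (cball 0 \<eta>) \<phi>"
  proof (rule lipschitz_onI)
    show "dist (\<phi> z) (\<phi> z') \<le> B * dist z z'" if "z \<in> cball 0 \<eta>" "z' \<in> cball 0 \<eta>" for z z'
      using le[OF that] le[OF that(2,1)] by (simp add: dist_real_def abs_le_iff dist_commute)
  qed (use B in simp)
  then have cont\<phi>: "continuous_on (cball 0 \<eta>) \<phi>"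
    by (rule lipschitz_on_continuous_on)
  have clU: "closed U" using \<open>subspace U\<close> by (rule closed_subspace)
  have 0: "0 \<in> cball 0 \<eta>" "0 \<in> U" using \<open>\<eta> > 0\<close> \<open>subspace U\<close> by (auto simp: subspace_0)
  \<comment> \<open>By \<open>m0\<close> the point 0 minimises \<phi> on the ball, and
    \<open>only0\<close> makes this minimum strict along \<open>U\<close>. Compactness turns
    strictness into a uniform gap \<open>c\<close> on the sphere; for trivial \<open>U\<close> that
    sphere is empty.\<close>
  have "\<exists>c>0. \<forall>z \<in> U \<inter> sphere 0 \<eta>. \<phi> 0 + c \<le> \<phi> z"
  proof (cases "U \<inter> sphere 0 \<eta> = {}")
    case True
    then show ?thesis by (intro exI[of _ 1]) auto
  next
    case False
    have "compact (U \<inter> sphere 0 \<eta>)" using clU by (intro closed_Int_compact) auto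
    moreover have "continuous_on (U \<inter> sphere 0 \<eta>) \<phi>"
      by (rule continuous_on_subset[OF cont\<phi>]) auto
    ultimately obtain z where z: "z \<in> U" "norm z = \<eta>"
      and min: "\<And>y. y \<in> U \<inter> sphere 0 \<eta> \<Longrightarrow> \<phi> z \<le> \<phi> y"
      using continuous_attains_inf[of "U \<inter> sphere 0 \<eta>" \<phi>] False by (metis IntE mem_sphere_0)
    have "\<phi> 0 \<le> \<phi> z" using \<phi>[of 0 z] z m0 0 by simp
    moreover have "\<phi> 0 \<noteq> \<phi> z"
      using only0[of z] z \<open>\<eta> > 0\<close> by (auto simp: \<phi>_def)
    ultimately show ?thesis
      using min by (intro exI[of _ "\<phi> z - \<phi> 0"]) auto
  qed
  then obtain c where c: "c > 0" "\<And>z. z \<in> U \<Longrightarrow> norm z = \<eta> \<Longrightarrow> \<phi> 0 + c \<le> \<phi> z"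
    by auto
  show ?thesis
  proof (rule that)
    \<comment> \<open>With this radius the linear term is at most \<open>c / 2\<close> on the
      sphere, which is less than the gap, so 0 beats every point of the sphere.\<close>
    show "c / (2 * \<eta>) > 0" using c \<open>\<eta> > 0\<close> by simp
    fix u assume u: "u \<in> U" "norm u \<le> c / (2 * \<eta>)"
    have "compact (U \<inter> cball 0 \<eta>)" using clU by (intro closed_Int_compact) auto
    moreover have "continuous_on (U \<inter> cball 0 \<eta>) (\<lambda>z. z \<bullet> u - \<phi> z)"
      by (intro continuous_intros continuous_on_subset[OF cont\<phi>]) auto
    moreover have "U \<inter> cball 0 \<eta> \<noteq> {}" using 0 by blast
    ultimately obtain z where z: "z \<in> U" "norm z \<le> \<eta>"
      and max: "\<And>y. y \<in> U \<Longrightarrow> norm y \<le> \<eta> \<Longrightarrow> y \<bullet> u - \<phi> y \<le> z \<bullet> u - \<phi> z"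
      using continuous_attains_sup[of "U \<inter> cball 0 \<eta>" "\<lambda>z. z \<bullet> u - \<phi> z"]
      by (metis IntE IntI mem_cball_0)
    have "norm z \<noteq> \<eta>"
    proof
      assume n: "norm z = \<eta>"
      have "z \<bullet> u \<le> norm z * norm u" by (rule norm_cauchy_schwarz)
      also have "\<dots> \<le> \<eta> * (c / (2 * \<eta>))" using u(2) n \<open>\<eta> > 0\<close> by (auto intro: mult_left_mono simp del: times_divide_eq_right)
      also have "\<dots> = c / 2" using \<open>\<eta> > 0\<close> by simp
      finally have "z \<bullet> u \<le> c / 2" .
      then show False using max[of 0] c(2)[OF z(1) n] \<open>c > 0\<close> 0 by simp
    qed
    then have zlt: "norm z < \<eta>" using z by simp
    \<comment> \<open>Maximality bounds the increment of \<phi> from \<open>z\<close> to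
      \<open>z + t w\<close> below by \<open>t * (w \<bullet> u)\<close>, and the subgradient at
      \<open>z + t w\<close> bounds it above by \<open>t * (w \<bullet> m (z + t w))\<close>. Divide
      by \<open>t\<close> and let \<open>t\<close> decrease to 0, using continuity of
      \<open>m\<close>. Equality follows by applying this to \<open>w\<close> and
      \<open>- w\<close>.\<close>
    have ge: "w \<bullet> u \<le> w \<bullet> m z" if w: "w \<in> U" for w
    proof -
      have "((\<lambda>t. z + t *\<^sub>R w) \<longlongrightarrow> z + 0 *\<^sub>R w) (at_right 0)"
        by (intro tendsto_intros)
      then have lim: "((\<lambda>t. z + t *\<^sub>R w) \<longlongrightarrow> z) (at_right 0)" by simp
      have "isCont m z"
        using cont zlt by (intro continuous_on_interior[of "cball 0 \<eta>"]) (auto simp: interior_cball)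
      then have "((\<lambda>t. w \<bullet> m (z + t *\<^sub>R w)) \<longlongrightarrow> w \<bullet> m z) (at_right 0)"
        by (intro tendsto_intros isCont_tendsto_compose[OF _ lim])
      moreover have "\<forall>\<^sub>F t in at_right 0. w \<bullet> u \<le> w \<bullet> m (z + t *\<^sub>R w)"
      proof -
        have "\<forall>\<^sub>F t in at_right 0. norm (z + t *\<^sub>R w) < \<eta>"
          using zlt by (intro order_tendstoD(2)[OF tendsto_norm[OF lim]])
        moreover have "\<forall>\<^sub>F t::real in at_right 0. t > 0" by (rule eventually_at_right_less)
        ultimately show ?thesis
        proof eventually_elim
          case (elim t)
          have "z + t *\<^sub>R w \<in> U" using z w \<open>subspace U\<close> by (simp add: subspace_add subspace_scale)
          then have "t * (w \<bullet> u) \<le> \<phi> (z + t *\<^sub>R w) - \<phi> z"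
            using max[of "z + t *\<^sub>R w"] elim by (simp add: inner_add_left)
          also have "\<dots> \<le> t * (w \<bullet> m (z + t *\<^sub>R w))"
            using \<phi>[of "z + t *\<^sub>R w" z] elim zlt by simp
          finally show ?case using elim by simp
        qed
      qed
      ultimately show ?thesis by (intro tendsto_lowerbound) auto
    qed
    have "m z - u \<in> U\<^sup>\<bottom>"
    proof -
      have "w \<bullet> (m z - u) = 0" if "w \<in> U" for w
        using ge[OF that] ge[OF subspace_neg[OF \<open>subspace U\<close> that]] by (simp add: inner_diff_right)
      then show ?thesis by (simp add: orthogonal_comp_def orthogonal_def)
    qed
    then show "\<exists>z\<in>U. norm z \<le> \<eta> \<and> m z - u \<in> U\<^sup>\<bottom>" using z by blast
  qed
qed

section \<open>Subgradients relative to a subspace\<close>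

text \<open>The bound \<open>B\<close> makes sequences of subgradients bounded, so that limits can
  be extracted. The inequality is local, on the ball of radius \<delta>, since \<open>l\<close> will
  be controlled only near 0.\<close>

definition subgrads ::
    "'a::euclidean_space set \<Rightarrow> real \<Rightarrow> real \<Rightarrow> ('a \<Rightarrow> real) \<Rightarrow> 'a \<Rightarrow> 'a set" where
  "subgrads U \<delta> B l u =
     {z \<in> U. norm z \<le> B \<and> (\<forall>w \<in> U \<inter> cball 0 \<delta>. l u + z \<bullet> (w - u) \<le> l w)}"

lemma subgradsD:
  assumes "z \<in> subgrads U \<delta> B l u" "w \<in> U" "norm w \<le> \<delta>"
  shows "l u + z \<bullet> (w - u) \<le> l w"
  using assms by (simp add: subgrads_def)

text \<open>Passing to the limit in the subgradient inequality needs lower semicontinuity of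
  \<open>l\<close> at \<open>a\<close>. Any subgradient \<open>c\<close> at \<open>a\<close>
  supplies it: \<open>l (u k)\<close> is at least
  \<open>l a + c \<bullet> (u k - a)\<close>.\<close>

lemma subgrads_limit:
  assumes "closed U" and u: "\<And>k. u k \<in> U \<inter> cball 0 \<delta>" "u \<longlonglongrightarrow> a"
    and z: "\<And>k. z k \<in> subgrads U \<delta> B l (u k)" "z \<longlonglongrightarrow> b"
    and ne: "subgrads U \<delta> B l a \<noteq> {}"
  shows "b \<in> subgrads U \<delta> B l a"
proof -
  obtain c where c: "c \<in> subgrads U \<delta> B l a" using ne by auto
  have "b \<in> U" using z \<open>closed U\<close> by (auto simp: subgrads_def intro: closed_sequentially)
  moreover have "norm b \<le> B"
    using tendsto_norm[OF z(2)] z(1) by (auto simp: subgrads_def intro!: LIMSEQ_le_const2)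
  moreover have "l a + b \<bullet> (w - a) \<le> l w" if w: "w \<in> U \<inter> cball 0 \<delta>" for w
  proof (rule LIMSEQ_le_const2)
    have "(\<lambda>k. l a + c \<bullet> (u k - a) + z k \<bullet> (w - u k)) \<longlonglongrightarrow> l a + c \<bullet> (a - a) + b \<bullet> (w - a)"
      by (intro tendsto_intros u z)
    then show "(\<lambda>k. l a + c \<bullet> (u k - a) + z k \<bullet> (w - u k)) \<longlonglongrightarrow> l a + b \<bullet> (w - a)" by simp
    have "l a + c \<bullet> (u k - a) + z k \<bullet> (w - u k) \<le> l w" for k
    proof -
      have "l a + c \<bullet> (u k - a) \<le> l (u k)" using c u(1)[of k] by (simp add: subgrads_def)
      moreover have "l (u k) + z k \<bullet> (w - u k) \<le> l w" using z(1)[of k] w by (simp add: subgrads_def)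
      ultimately show ?thesis by simp
    qed
    then show "\<exists>N. \<forall>k\<ge>N. l a + c \<bullet> (u k - a) + z k \<bullet> (w - u k) \<le> l w" by blast
  qed
  ultimately show ?thesis by (simp add: subgrads_def)
qed

lemma subgrads_bounded: "bounded (range z)" if "\<And>k. z k \<in> subgrads U \<delta> B l (u k)"
  using that by (auto simp: subgrads_def bounded_iff intro!: exI[of _ B])

text \<open>If \<open>s\<close> is a subgradient at \<open>y\<close>, the two subgradient
  inequalities between \<open>u\<close> and \<open>y\<close> trap the linearisation error between 0
  and \<open>(s - z) \<bullet> (y - u)\<close>. By \<open>subgrads_limit\<close> and uniqueness at
  \<open>u\<close>, subgradients at points tending to \<open>u\<close> accumulate only at
  \<open>z\<close>, so the error is of smaller order than \<open>norm (y - u)\<close>.\<close>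

lemma unique_subgrad_has_derivative:
  assumes "closed U" and u: "u \<in> U" "norm u < \<delta>"
    and ne: "\<And>w. w \<in> U \<inter> cball 0 \<delta> \<Longrightarrow> subgrads U \<delta> B l w \<noteq> {}"
    and uniq: "subgrads U \<delta> B l u = {z}"
  shows "(l has_derivative (\<lambda>h. z \<bullet> h)) (at u within U)"
  unfolding has_derivative_within_alt
proof (intro conjI allI impI)
  show "bounded_linear (\<lambda>h. z \<bullet> h)" by (rule bounded_linear_inner_right)
  fix e :: real assume "e > 0"
  show "\<exists>d>0. \<forall>y\<in>U. norm (y - u) < d \<longrightarrow> norm (l y - l u - z \<bullet> (y - u)) \<le> e * norm (y - u)"
  proof (rule ccontr)
    \<comment> \<open>The first term keeps the bad points \<open>y k\<close> in the ball where
      subgradients exist; the second makes them converge to \<open>u\<close>.\<close>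
    define d where "d k = min (\<delta> - norm u) (inverse (real (Suc k)))" for k
    have d: "d k > 0" for k using u by (simp add: d_def)
    assume "\<not> ?thesis"
    then have "\<forall>k. \<exists>y\<in>U. norm (y - u) < d k \<and> e * norm (y - u) < norm (l y - l u - z \<bullet> (y - u))"
      using d by (meson not_le)
    then obtain y where y: "\<And>k. y k \<in> U" "\<And>k. norm (y k - u) < d k"
      and far: "\<And>k. e * norm (y k - u) < norm (l (y k) - l u - z \<bullet> (y k - u))"
      by metis
    have yb: "y k \<in> U \<inter> cball 0 \<delta>" for k
      using y[of k] norm_triangle_sub[of "y k" u] by (simp add: d_def)
    have "\<exists>s. s \<in> subgrads U \<delta> B l (y k)" for k using ne[OF yb[of k]] by blast
    then obtain s where s: "\<And>k. s k \<in> subgrads U \<delta> B l (y k)" by metis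
    have "(\<lambda>k. norm (y k - u)) \<longlonglongrightarrow> 0"
      by (rule tendsto_sandwich[OF _ _ tendsto_const LIMSEQ_inverse_real_of_nat])
         (use y(2) in \<open>auto simp: d_def intro!: always_eventually less_imp_le\<close>)
    then have lim: "y \<longlonglongrightarrow> u" using LIM_zero_cancel tendsto_norm_zero_iff by blast
    obtain b r where r: "strict_mono r" "(s \<circ> r) \<longlonglongrightarrow> b"
      using bounded_imp_convergent_subsequence[OF subgrads_bounded[of s U \<delta> B l y, OF s]] by blast
    have "b \<in> subgrads U \<delta> B l u"
    proof (rule subgrads_limit[OF \<open>closed U\<close>])
      show "(y \<circ> r) k \<in> U \<inter> cball 0 \<delta>" for k using yb by simp
      show "(y \<circ> r) \<longlonglongrightarrow> u" using LIMSEQ_subseq_LIMSEQ[OF lim r(1)] .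
      show "(s \<circ> r) k \<in> subgrads U \<delta> B l ((y \<circ> r) k)" for k using s by simp
      show "subgrads U \<delta> B l u \<noteq> {}" using uniq by simp
    qed (rule r(2))
    then have "(s \<circ> r) \<longlonglongrightarrow> z" using uniq r by simp
    moreover have "e < norm (s k - z)" for k
    proof -
      have z: "z \<in> subgrads U \<delta> B l u" using uniq by simp
      have "l u + z \<bullet> (y k - u) \<le> l (y k)" using z yb[of k] by (simp add: subgrads_def)
      moreover have "l (y k) + s k \<bullet> (u - y k) \<le> l u" using s[of k] u by (simp add: subgrads_def)
      ultimately have "norm (l (y k) - l u - z \<bullet> (y k - u)) \<le> (s k - z) \<bullet> (y k - u)"
        by (simp add: inner_diff_left inner_diff_right)
      also have "\<dots> \<le> norm (s k - z) * norm (y k - u)" by (rule norm_cauchy_schwarz)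
      finally have "e * norm (y k - u) < norm (s k - z) * norm (y k - u)" using far[of k] by simp
      then show ?thesis by (simp add: mult_less_cancel_right)
    qed
    ultimately show False
      using \<open>e > 0\<close> LIMSEQ_D[of "s \<circ> r" z e] by (metis comp_apply less_asym order_refl)
  qed
qed

section \<open>Second-order expansion and kinks\<close>

lemma C2_on_taylor:
  fixes X :: "(real^'n) set"
  assumes "subspace X" "C2_on X \<psi> G H" "x \<in> X" "e > 0"
  shows "\<forall>\<^sub>F w in at 0 within X.
    \<bar>\<psi> (x + w) - \<psi> x - G x \<bullet> w - 1 / 2 * (w \<bullet> (H x *v w))\<bar> \<le> e * (norm w)\<^sup>2"
proof -
  have G: "(G has_derivative (\<lambda>h. H x *v h)) (at x within X)"
    using assms by (simp add: C2_on_def)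
  obtain d where d: "d > 0"
    "\<And>y. y \<in> X \<Longrightarrow> norm (y - x) < d \<Longrightarrow> norm (G y - G x - H x *v (y - x)) \<le> e * norm (y - x)"
    using G \<open>e > 0\<close> unfolding has_derivative_within_alt by blast
  have "\<bar>\<psi> (x + w) - \<psi> x - G x \<bullet> w - 1 / 2 * (w \<bullet> (H x *v w))\<bar> \<le> e * (norm w)\<^sup>2"
    if w: "w \<in> X" "norm w < d" for w
  proof -
    \<comment> \<open>\<open>R\<close> is the function along the segment with its first and second
      order terms removed. By the mean value theorem its increment over the unit interval is
      \<open>R' t\<close> for some intermediate \<open>t\<close>, and differentiability of
      \<open>G\<close> at \<open>x\<close> bounds that by
      \<open>e * (norm w)\<^sup>2\<close>.\<close>
    define R where "R t = \<psi> (x + t *\<^sub>R w) - t * (G x \<bullet> w) - t\<^sup>2 / 2 * (w \<bullet> (H x *v w))" for t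
    define R' where "R' t = G (x + t *\<^sub>R w) \<bullet> w - G x \<bullet> w - t * (w \<bullet> (H x *v w))" for t
    have inX: "x + t *\<^sub>R w \<in> X" for t
      using assms w by (simp add: subspace_add subspace_scale)
    have "(R has_derivative (\<lambda>h. h * R' t)) (at t)" for t
    proof -
      have line: "((\<lambda>t. x + t *\<^sub>R w) has_derivative (\<lambda>h. h *\<^sub>R w)) (at t)"
        by (auto intro!: derivative_eq_intros)
      have "(\<psi> has_derivative (\<lambda>h. G y \<bullet> h)) (at y within X)" if "y \<in> X" for y
        using assms that by (simp add: C2_on_def)
      from has_derivative_in_compose2[OF this _ UNIV_I line]
      have "((\<lambda>t. \<psi> (x + t *\<^sub>R w)) has_derivative (\<lambda>h. G (x + t *\<^sub>R w) \<bullet> (h *\<^sub>R w))) (at t)"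
        using inX by blast
      then show ?thesis
        unfolding R_def R'_def by (auto intro!: derivative_eq_intros simp: algebra_simps)
    qed
    then obtain t where t: "0 < t" "t < 1" and "R 1 - R 0 = 1 * R' t"
      using mvt_simple[of 0 1 R "\<lambda>t h. h * R' t"]
      by (metis diff_zero greaterThanLessThan_iff has_derivative_at_withinI zero_less_one)
    then have "\<psi> (x + w) - \<psi> x - G x \<bullet> w - 1 / 2 * (w \<bullet> (H x *v w)) = R' t"
      by (simp add: R_def)
    also have "R' t = (G (x + t *\<^sub>R w) - G x - H x *v (t *\<^sub>R w)) \<bullet> w"
      by (simp add: R'_def inner_diff_left inner_diff_right inner_commute matrix_vector_mult_scaleR)
    also have "\<bar>\<dots>\<bar> \<le> norm (G (x + t *\<^sub>R w) - G x - H x *v (t *\<^sub>R w)) * norm w"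
      by (rule Cauchy_Schwarz_ineq2)
    also have "\<dots> \<le> (e * norm (t *\<^sub>R w)) * norm w"
    proof (intro mult_right_mono)
      have "norm (t *\<^sub>R w) \<le> norm w" using t by (simp add: mult_left_le_one_le)
      then show "norm (G (x + t *\<^sub>R w) - G x - H x *v (t *\<^sub>R w)) \<le> e * norm (t *\<^sub>R w)"
        using d(2)[OF inX[of t]] w by simp
    qed simp
    also have "\<dots> \<le> e * norm w * norm w"
      using t \<open>e > 0\<close> by (intro mult_right_mono mult_left_mono) (auto simp: mult_left_le_one_le)
    finally show ?thesis by (simp add: power2_eq_square mult.assoc)
  qed
  then show ?thesis using d(1) by (auto simp: eventually_at dist_norm)
qed

text \<open>The matrix is K h h^T, the Hessian of
  \<open>K / 2 * (h \<bullet> (y - x))\<^sup>2\<close>. However large \<open>K\<close> is, this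
  quadratic lies below \<open>s * \<bar>h \<bullet> (y - x)\<bar>\<close> once \<open>y\<close> is
  close to \<open>x\<close>, so a kink admits arbitrarily large curvature in direction
  \<open>h\<close>.\<close>

lemma kink_mem_subjet:
  fixes f :: "real^'n \<Rightarrow> ereal"
  assumes fin: "\<bar>f x\<bar> \<noteq> \<infinity>" and "s > 0" "K > 0"
    and kink: "\<forall>\<^sub>F y in nhds x. f x + ereal (z \<bullet> (y - x) + s * \<bar>h \<bullet> (y - x)\<bar>) \<le> f y"
  shows "(z, \<chi> i. (K * h $ i) *\<^sub>R h) \<in> subjet UNIV f x"
proof -
  define A :: "real^'n^'n" where "A = (\<chi> i. (K * h $ i) *\<^sub>R h)"
  define \<psi> where "\<psi> y = z \<bullet> y + K / 2 * (h \<bullet> (y - x))\<^sup>2" for y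
  define G where "G y = z + (K * (h \<bullet> (y - x))) *\<^sub>R h" for y
  have A: "A *v w = (K * (h \<bullet> w)) *\<^sub>R h" for w
    by (simp add: A_def vec_eq_iff matrix_vector_mul_component)
  have "C2_on UNIV \<psi> G (\<lambda>_. A)"
    unfolding C2_on_def
  proof (intro conjI ballI)
    show "A *v w = 0" if "w \<in> UNIV\<^sup>\<bottom>" for w
      using that by (simp add: orthogonal_comp_UNIV)
    show "(\<psi> has_derivative (\<bullet>) (G y)) (at y within UNIV)" for y
      unfolding \<psi>_def G_def
      by (auto intro!: derivative_eq_intros simp: fun_eq_iff inner_add_left inner_add_right inner_commute[of _ h] inner_commute[of z] power2_eq_square)
    show "(G has_derivative (*v) A) (at y within UNIV)" for y
      unfolding G_def
      by (auto intro!: derivative_eq_intros simp: fun_eq_iff A)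
  qed auto
  moreover have "z = G x" by (simp add: G_def)
  moreover have "\<forall>\<^sub>F y in nhds x. f x - ereal (\<psi> x) \<le> f y - ereal (\<psi> y)"
  proof -
    have "((\<lambda>y. K / 2 * \<bar>h \<bullet> (y - x)\<bar>) \<longlongrightarrow> K / 2 * \<bar>h \<bullet> (x - x)\<bar>) (nhds x)"
      by (intro tendsto_intros filterlim_ident)
    then have "\<forall>\<^sub>F y in nhds x. K / 2 * \<bar>h \<bullet> (y - x)\<bar> < s"
      using \<open>s > 0\<close> by (intro order_tendstoD(2)) auto
    then show ?thesis using kink
    proof eventually_elim
      case (elim y)
      have "K / 2 * (h \<bullet> (y - x))\<^sup>2 = (K / 2 * \<bar>h \<bullet> (y - x)\<bar>) * \<bar>h \<bullet> (y - x)\<bar>"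
        by (simp add: power2_eq_square mult.assoc flip: abs_mult)
      also have "\<dots> \<le> s * \<bar>h \<bullet> (y - x)\<bar>" using elim by (intro mult_right_mono) auto
      finally have "\<psi> y - \<psi> x \<le> z \<bullet> (y - x) + s * \<bar>h \<bullet> (y - x)\<bar>"
        by (simp add: \<psi>_def inner_diff_right)
      then show ?case using elim(2) fin
        by (cases "f x"; cases "f y") auto
    qed
  qed
  ultimately show ?thesis
    using fin unfolding subjet_def A_def[symmetric]
    by (auto intro!: exI[of _ \<psi>] exI[of _ G] exI[of _ "\<lambda>_. A"] simp: eventually_nhds_conv_at)
qed

section \<open>The setting and the orthogonal splitting\<close>

text \<open>Here \<open>argmin\<close> is the common-minimiser hypothesis at the tilt z_V = 0, and
  \<open>dom_U\<close> is the second-order condition that will rule out kinks.\<close>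

locale tilt_stable_valley =
  fixes f :: "real^'n \<Rightarrow> ereal" and xbar :: "real^'n" and U V :: "(real^'n) set"
    and \<epsilon> :: real and v :: "real^'n \<Rightarrow> real^'n"
  assumes not_MInf: "\<And>x. f x \<noteq> -\<infinity>"
    and lsc: "lsc_fun f"
    and U_eq: "U = U_space f xbar 0"
    and V_eq: "V = V_space f xbar 0"
    and dom_U: "dom_rank1_support (lim_subhess f xbar 0) = U"
    and tilt: "tilt_stable_min f xbar \<epsilon>"
    and argmin: "\<And>u. u \<in> U \<Longrightarrow> norm u \<le> \<epsilon> \<Longrightarrow>
      argmin_on (\<lambda>w. f (xbar + u + w)) (V \<inter> cball 0 \<epsilon>) = {v u}"
begin

text \<open>Infinite values are sent to 0 by \<open>real_of_ereal\<close>, so \<open>l\<close>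
  represents f along the valley only where f is finite there; \<open>valley_subgradients\<close>
  provides a ball on which this holds.\<close>

definition l :: "real^'n \<Rightarrow> real" where
  "l u = real_of_ereal (f (xbar + u + v u))"

lemma U_comp: "U = V\<^sup>\<bottom>"
  by (simp add: U_eq V_eq U_space_def)

lemma subspace_V: "subspace V"
  by (simp add: V_eq V_space_def)

lemma subspace_U: "subspace U"
  by (simp add: U_comp subspace_orthogonal_comp)

lemma closed_U: "closed U"
  using subspace_U by (rule closed_subspace)

lemma comp_U: "U\<^sup>\<bottom> = V"
  by (simp add: U_comp orthogonal_comp_self subspace_V)

lemma U_perp_V: "a \<in> U \<Longrightarrow> w \<in> V \<Longrightarrow> a \<bullet> w = 0"
  by (auto simp: U_comp orthogonal_comp_def orthogonal_def inner_commute)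

lemma UV_norm_le:
  assumes "a \<in> U" "w \<in> V"
  shows "norm a \<le> norm (a + w)" "norm w \<le> norm (a + w)"
proof -
  have "(norm (a + w))\<^sup>2 = (norm a)\<^sup>2 + (norm w)\<^sup>2"
    using assms by (intro norm_add_Pythagorean) (simp add: orthogonal_def U_perp_V)
  then have "(norm a)\<^sup>2 \<le> (norm (a + w))\<^sup>2" "(norm w)\<^sup>2 \<le> (norm (a + w))\<^sup>2" by auto
  then show "norm a \<le> norm (a + w)" "norm w \<le> norm (a + w)"
    by (auto intro: power2_le_imp_le)
qed

lemma UV_decomp:
  obtains a w where "a \<in> U" "w \<in> V" "x = a + w"
proof -
  obtain w a where *: "w \<in> span V" "\<And>y. y \<in> span V \<Longrightarrow> orthogonal a y" "x = w + a"
    using orthogonal_subspace_decomp_exists[of V x] by metis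
  then have "a \<in> U"
    by (simp add: U_comp orthogonal_comp_def orthogonal_commute span_base)
  moreover have "w \<in> V" using *(1) subspace_V by (metis span_eq_iff)
  moreover have "x = a + w" using *(3) by simp
  ultimately show ?thesis by (rule that)
qed

lemma eps_pos: "\<epsilon> > 0" and fin_xbar: "\<bar>f xbar\<bar> \<noteq> \<infinity>"
  using tilt by (auto simp: tilt_stable_min_def)

text \<open>A local affine minorant makes \<open>z\<close> a proximal subgradient with r = 0, and
  constant sequences make it a limiting one. Since zbar = 0, it then lies in \<open>V\<close> as
  well as in \<open>U\<close>.\<close>

lemma subgrad_in_U_zero:
  assumes "z \<in> U" "\<forall>\<^sub>F y in nhds xbar. f xbar + ereal (z \<bullet> (y - xbar)) \<le> f y"
  shows "z = 0"
proof -
  have "z \<in> prox_subdiff f xbar"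
    using assms fin_xbar by (auto simp: prox_subdiff_def intro!: exI[of _ 0])
  then have "z \<in> lim_subdiff f xbar"
    unfolding lim_subdiff_def converges_wrt_def mem_Collect_eq
    by (intro exI[of _ "\<lambda>_. xbar"] exI[of _ "\<lambda>_. z"]) auto
  then have "z \<in> V"
    by (auto simp: V_eq V_space_def intro: span_base)
  then show ?thesis using U_perp_V[OF \<open>z \<in> U\<close>] by force
qed

lemma v_argmin:
  assumes "u \<in> U" "norm u \<le> \<epsilon>"
  shows "v u \<in> V" "norm (v u) \<le> \<epsilon>"
    "\<And>w. w \<in> V \<Longrightarrow> norm w \<le> \<epsilon> \<Longrightarrow> f (xbar + u + v u) \<le> f (xbar + u + w)"
    "\<And>w. w \<in> V \<Longrightarrow> norm w \<le> \<epsilon> \<Longrightarrow> f (xbar + u + w) \<le> f (xbar + u + v u) \<Longrightarrow> w = v u"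
proof -
  have am: "w \<in> argmin_on (\<lambda>w. f (xbar + u + w)) (V \<inter> cball 0 \<epsilon>) \<longleftrightarrow> w = v u" for w
    using argmin[OF assms] by simp
  have vu: "v u \<in> V" "norm (v u) \<le> \<epsilon>"
    "\<And>w. w \<in> V \<Longrightarrow> norm w \<le> \<epsilon> \<Longrightarrow> f (xbar + u + v u) \<le> f (xbar + u + w)"
    using am[of "v u"] by (auto simp: argmin_on_def is_arg_min_def not_less)
  then show "v u \<in> V" "norm (v u) \<le> \<epsilon>"
    "\<And>w. w \<in> V \<Longrightarrow> norm w \<le> \<epsilon> \<Longrightarrow> f (xbar + u + v u) \<le> f (xbar + u + w)" by auto
  fix w assume w: "w \<in> V" "norm w \<le> \<epsilon>" and le: "f (xbar + u + w) \<le> f (xbar + u + v u)"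
  have "f (xbar + u + w) \<le> f (xbar + u + y)" if "y \<in> V" "norm y \<le> \<epsilon>" for y
    using le vu(3)[OF that] by (rule order_trans)
  then show "w = v u"
    using am[of w] w by (auto simp: argmin_on_def is_arg_min_def not_less)
qed

section \<open>Minimisers of the tilted functions\<close>

text \<open>Minimality of \<open>y\<close> for the tilt \<open>z\<close>, in coordinates centred at
  \<open>xbar\<close>. The tilt is moved to one side so that no extended real is subtracted, and the
  last clause records that the minimiser is unique.\<close>

definition tilt_min :: "real^'n \<Rightarrow> real^'n \<Rightarrow> bool" where
  "tilt_min z y \<longleftrightarrow> norm y \<le> \<epsilon> \<and> \<bar>f (xbar + y)\<bar> \<noteq> \<infinity> \<and>
     (\<forall>x. norm x \<le> \<epsilon> \<longrightarrow> f (xbar + y) + ereal (z \<bullet> (x - y)) \<le> f (xbar + x)) \<and>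
     (\<forall>x. norm x \<le> \<epsilon> \<longrightarrow> f (xbar + x) \<le> f (xbar + y) + ereal (z \<bullet> (x - y)) \<longrightarrow> x = y)"

lemma tilt_minD:
  assumes "tilt_min z y"
  shows "norm y \<le> \<epsilon>" "\<bar>f (xbar + y)\<bar> \<noteq> \<infinity>"
    "\<And>x. norm x \<le> \<epsilon> \<Longrightarrow> f (xbar + y) + ereal (z \<bullet> (x - y)) \<le> f (xbar + x)"
    "\<And>x. norm x \<le> \<epsilon> \<Longrightarrow> f (xbar + x) \<le> f (xbar + y) + ereal (z \<bullet> (x - y)) \<Longrightarrow> x = y"
  using assms by (simp_all add: tilt_min_def)

lemma tilt_minimisers:
  obtains \<eta> m where "\<eta> > 0" "continuous_on (cball 0 \<eta>) m" "m 0 = 0"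
    "\<And>z. z \<in> cball 0 \<eta> \<Longrightarrow> tilt_min z (m z)"
proof -
  obtain N M K where N: "open N" "0 \<in> N" and lip: "K-lipschitz_on N M" and M0: "M 0 = xbar"
    and am: "\<And>z. z \<in> N \<Longrightarrow> argmin_on (\<lambda>x. f x - ereal (x \<bullet> z)) (cball xbar \<epsilon>) = {M z}"
    using tilt unfolding tilt_stable_min_def by blast
  obtain \<eta> where \<eta>: "\<eta> > 0" "cball 0 \<eta> \<subseteq> N"
    using N open_contains_cball by blast
  define m where "m z = M z - xbar" for z
  show ?thesis
  proof (rule that[of \<eta> m])
    show "continuous_on (cball 0 \<eta>) m"
      unfolding m_def
      by (intro continuous_intros continuous_on_subset[OF lipschitz_on_continuous_on[OF lip]] \<eta>)
    show "m 0 = 0" by (simp add: m_def M0)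
    fix z :: "real^'n" assume z: "z \<in> cball 0 \<eta>"
    have M: "x \<in> argmin_on (\<lambda>x. f x - ereal (x \<bullet> z)) (cball xbar \<epsilon>) \<longleftrightarrow> x = M z" for x
      using am z \<eta> by auto
    have Mz: "M z \<in> cball xbar \<epsilon>"
      and min: "\<And>y. y \<in> cball xbar \<epsilon> \<Longrightarrow> f (M z) - ereal (M z \<bullet> z) \<le> f y - ereal (y \<bullet> z)"
      using M[of "M z"] by (auto simp: argmin_on_def is_arg_min_def not_less)
    have "norm (m z) \<le> \<epsilon>" using Mz by (simp add: m_def dist_norm norm_minus_commute)
    have eq: "xbar + m z = M z" by (simp add: m_def)
    \<comment> \<open>The tilted value at \<open>M z\<close> is at most the one at
      \<open>xbar\<close>, which is finite.\<close>
    have fin: "\<bar>f (M z)\<bar> \<noteq> \<infinity>"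
      using min[of xbar] fin_xbar eps_pos not_MInf[of "M z"] by (cases "f (M z)"; cases "f xbar") auto
    have "f (xbar + m z) + ereal (z \<bullet> (x - m z)) \<le> f (xbar + x)" if "norm x \<le> \<epsilon>" for x
    proof -
      have xin: "xbar + x \<in> cball xbar \<epsilon>" using that by (simp add: dist_norm)
      show ?thesis
        using min[OF xin] fin not_MInf[of "xbar + x"]
        by (cases "f (M z)"; cases "f (xbar + x)")
           (auto simp: eq, auto simp: m_def algebra_simps inner_commute)
    qed
    moreover have "x = m z" if "norm x \<le> \<epsilon>"
      and le: "f (xbar + x) \<le> f (xbar + m z) + ereal (z \<bullet> (x - m z))" for x
    proof -
      have xin: "xbar + x \<in> cball xbar \<epsilon>" using that by (simp add: dist_norm)
      have "f (xbar + x) - ereal ((xbar + x) \<bullet> z) \<le> f (M z) - ereal (M z \<bullet> z)"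
        using le fin not_MInf[of "xbar + x"] unfolding eq
        by (cases "f (M z)"; cases "f (xbar + x)")
           (auto simp: m_def algebra_simps inner_commute)
      then have "f (xbar + x) - ereal ((xbar + x) \<bullet> z) \<le> f y - ereal (y \<bullet> z)"
        if "y \<in> cball xbar \<epsilon>" for y
        using min[OF that] by (rule order_trans)
      then have "xbar + x = M z"
        using xin M[of "xbar + x"] by (auto simp: argmin_on_def is_arg_min_def not_less)
      then show ?thesis by (simp add: m_def algebra_simps)
    qed
    ultimately show "tilt_min z (m z)"
      using \<open>norm (m z) \<le> \<epsilon>\<close> fin by (simp add: tilt_min_def eq)
  qed (rule \<eta>)
qed

lemma xbar_min:
  assumes "norm x \<le> \<epsilon>"
  shows "f xbar \<le> f (xbar + x)"
proof -
  obtain \<eta> m where "\<eta> > 0" "continuous_on (cball 0 \<eta>) m"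
    and m: "m 0 = 0" "\<And>z. z \<in> cball 0 \<eta> \<Longrightarrow> tilt_min z (m z)"
    by (rule tilt_minimisers) (rule that)
  have "tilt_min 0 0" using m(2)[of 0] \<open>\<eta> > 0\<close> unfolding m(1) by simp
  from tilt_minD(3)[OF this assms] show ?thesis by simp
qed

lemma v_zero: "v 0 = 0"
proof -
  have 0: "0 \<in> U" "norm (0::real^'n) \<le> \<epsilon>" "0 \<in> V"
    using subspace_U subspace_V eps_pos by (auto simp: subspace_0)
  have "f (xbar + 0 + 0) \<le> f (xbar + 0 + v 0)"
    using xbar_min[OF v_argmin(2)[OF 0(1,2)]] by simp
  from v_argmin(4)[OF 0(1,2,3,2) this] show ?thesis by simp
qed

text \<open>This transfers \<open>tilt_argmin_onto\<close> to f: every small \<open>u\<close> in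
  \<open>U\<close> is the \<open>U\<close>-component of a tilted minimiser whose tilt lies in
  \<open>U\<close> and is as small as desired.\<close>

lemma tilts_onto:
  assumes "c > 0"
  obtains \<delta> where "\<delta> > 0"
    "\<And>u. u \<in> U \<Longrightarrow> norm u \<le> \<delta> \<Longrightarrow> \<exists>z\<in>U. \<exists>y. norm z \<le> c \<and> y - u \<in> V \<and> tilt_min z y"
proof -
  obtain \<eta>0 m where \<eta>0: "\<eta>0 > 0" and m_cont: "continuous_on (cball 0 \<eta>0) m" and m0: "m 0 = 0"
    and m_min: "\<And>z. z \<in> cball 0 \<eta>0 \<Longrightarrow> tilt_min z (m z)"
    by (rule tilt_minimisers) (rule that)
  note m = m_cont m0 tilt_minD[OF m_min]
  define \<eta> where "\<eta> = min \<eta>0 c"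
  have \<eta>: "\<eta> > 0" "cball 0 \<eta> \<subseteq> (cball 0 \<eta>0 :: (real^'n) set)" using \<eta>0 assms by (auto simp: \<eta>_def)
  define p where "p z = real_of_ereal (f (xbar + m z))" for z
  have p: "f (xbar + m z) = ereal (p z)" if "z \<in> cball 0 \<eta>" for z
    using m(4)[of z] that \<eta> by (auto simp: p_def ereal_real)
  obtain \<delta> where \<delta>: "\<delta> > 0"
    "\<And>u. u \<in> U \<Longrightarrow> norm u \<le> \<delta> \<Longrightarrow> \<exists>z\<in>U. norm z \<le> \<eta> \<and> m z - u \<in> U\<^sup>\<bottom>"
  proof (rule tilt_argmin_onto[OF subspace_U \<eta>(1), of m p])
    show "continuous_on (cball 0 \<eta>) m" using m(1) \<eta>(2) by (rule continuous_on_subset)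
    show "p z + z \<bullet> (m z' - m z) \<le> p z'" if "z \<in> cball 0 \<eta>" "z' \<in> cball 0 \<eta>" for z z'
      using m(5)[of z "m z'"] m(3)[of z'] that subsetD[OF \<eta>(2)] by (simp add: p)
    \<comment> \<open>The equation says that 0 attains the minimum for the tilt \<open>z\<close>, so
      \<open>m z = 0\<close> by uniqueness. Then \<open>z\<close> is the slope of an affine minorant
      of f at \<open>xbar\<close>, and \<open>subgrad_in_U_zero\<close> applies.\<close>
    show "z = 0" if z: "z \<in> U" "z \<in> cball 0 \<eta>" and eq: "p 0 = p z - z \<bullet> m z" for z
    proof -
      have zin: "z \<in> cball 0 \<eta>0" using z \<eta> by auto
      have f0: "f xbar = ereal (p 0)" using p[of 0] \<eta> m(2) by simp
      have "0 = m z"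
        using eps_pos f0 eq p[OF z(2)] by (intro m(6)[OF zin]) (auto simp: inner_diff_right)
      then have *: "f xbar + ereal (z \<bullet> x) \<le> f (xbar + x)" if "norm x \<le> \<epsilon>" for x
        using m(5)[OF zin that] by simp
      have "\<forall>\<^sub>F y in nhds xbar. dist y xbar < \<epsilon>"
        using eps_pos by (auto simp: eventually_nhds_metric)
      then have "\<forall>\<^sub>F y in nhds xbar. f xbar + ereal (z \<bullet> (y - xbar)) \<le> f y"
      proof eventually_elim
        case (elim y)
        then show ?case using *[of "y - xbar"] by (simp add: dist_norm)
      qed
      then show ?thesis using z(1) by (intro subgrad_in_U_zero)
    qed
  qed (rule m0, rule that)
  show ?thesis
  proof (rule that[OF \<delta>(1)])
    fix u assume "u \<in> U" "norm u \<le> \<delta>"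
    then obtain z where z: "z \<in> U" "norm z \<le> \<eta>" "m z - u \<in> V"
      using \<delta>(2)[of u] by (auto simp: comp_U)
    then have zin: "z \<in> cball 0 \<eta>0" and "norm z \<le> c" by (auto simp: \<eta>_def)
    then show "\<exists>z\<in>U. \<exists>y. norm z \<le> c \<and> y - u \<in> V \<and> tilt_min z y"
      using z m_min[OF zin] by blast
  qed
qed

section \<open>Behaviour of the valley u + v(u) near the origin\<close>

text \<open>A tilted minimiser \<open>y\<close> over \<open>u\<close> lies no lower than the valley
  point, and comparing it with 0 gives f(xbar + y) at most f(xbar) + \<open>z \<bullet> y\<close>.
  As \<open>norm y\<close> is at most \<epsilon>, a tilt of size \<open>c / \<epsilon>\<close> keeps
  the excess below \<open>c\<close>.\<close>

lemma valley_usc: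
  assumes "c > 0"
  shows "\<exists>\<delta>>0. \<forall>u\<in>U. norm u \<le> \<delta> \<longrightarrow> f (xbar + u + v u) \<le> f xbar + ereal c"
proof -
  have "c / \<epsilon> > 0" using assms eps_pos by simp
  then obtain \<delta> where "\<delta> > 0" and \<delta>:
    "\<And>u. u \<in> U \<Longrightarrow> norm u \<le> \<delta> \<Longrightarrow> \<exists>z\<in>U. \<exists>y. norm z \<le> c / \<epsilon> \<and> y - u \<in> V \<and> tilt_min z y"
    by (rule tilts_onto) (rule that)
  show ?thesis
  proof (intro exI[of _ "min \<delta> \<epsilon>"] conjI ballI impI)
    show "min \<delta> \<epsilon> > 0" using \<open>\<delta> > 0\<close> eps_pos by simp
    fix u assume u: "u \<in> U" "norm u \<le> min \<delta> \<epsilon>"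
    then obtain z y where z: "z \<in> U" "norm z \<le> c / \<epsilon>" and y0: "y - u \<in> V"
      and zy: "tilt_min z y"
      using \<delta>[of u] by auto
    note sub = tilt_minD(3)[OF zy] and y = y0 tilt_minD(1,2)[OF zy]
    have "norm (y - u) \<le> \<epsilon>" using UV_norm_le(2)[OF u(1) y(1)] y(2) by simp
    then have "f (xbar + u + v u) \<le> f (xbar + y)"
      using v_argmin(3)[of u "y - u"] u y by simp
    moreover have "f (xbar + y) + ereal (z \<bullet> (0 - y)) \<le> f xbar"
      using sub[of 0] eps_pos by simp
    moreover have "z \<bullet> y \<le> c"
    proof -
      have "z \<bullet> y \<le> norm z * norm y" by (rule norm_cauchy_schwarz)
      also have "\<dots> \<le> c / \<epsilon> * \<epsilon>" using z y eps_pos assms by (intro mult_mono) auto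
      finally show ?thesis using eps_pos by simp
    qed
    ultimately show "f (xbar + u + v u) \<le> f xbar + ereal c"
      using y(3) fin_xbar
      by (cases "f (xbar + y)"; cases "f xbar"; cases "f (xbar + u + v u)") auto
  qed
qed

text \<open>Otherwise some valley points over \<open>u k\<close> tending to 0 have a limit
  \<open>xbar + w\<close> with w in \<open>V\<close> and \<open>e \<le> norm w\<close>. Lower
  semicontinuity and \<open>valley_usc\<close> give f(xbar + w) at most f(xbar), so \<open>w\<close>
  minimises over \<open>V\<close> at u = 0 and equals \<open>v 0 = 0\<close>.\<close>

lemma valley_continuous:
  assumes "e > 0"
  shows "\<exists>\<delta>>0. \<forall>u\<in>U. norm u \<le> \<delta> \<longrightarrow> norm (v u) < e"
proof (rule ccontr)
  assume no: "\<not> ?thesis"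
  have "\<exists>u\<in>U. norm u \<le> min \<epsilon> (inverse (real (Suc k))) \<and> e \<le> norm (v u) \<and>
          f (xbar + u + v u) \<le> f xbar + ereal (inverse (real (Suc k)))" for k
  proof -
    obtain \<delta> where \<delta>: "\<delta> > 0" "\<forall>u\<in>U. norm u \<le> \<delta> \<longrightarrow>
        f (xbar + u + v u) \<le> f xbar + ereal (inverse (real (Suc k)))"
      using valley_usc[of "inverse (real (Suc k))"] by auto
    have "min \<delta> (min \<epsilon> (inverse (real (Suc k)))) > 0" using \<delta> eps_pos by simp
    then obtain u where "u \<in> U" "norm u \<le> min \<delta> (min \<epsilon> (inverse (real (Suc k))))" "\<not> norm (v u) < e"
      using no by blast
    then show ?thesis using \<delta> by (intro bexI[of _ u]) auto
  qed
  then obtain u where u: "\<And>k. u k \<in> U" "\<And>k. norm (u k) \<le> min \<epsilon> (inverse (real (Suc k)))"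
    "\<And>k. e \<le> norm (v (u k))"
    "\<And>k. f (xbar + u k + v (u k)) \<le> f xbar + ereal (inverse (real (Suc k)))"
    by metis
  have vu: "v (u k) \<in> V" "norm (v (u k)) \<le> \<epsilon>" for k
    using v_argmin[of "u k"] u by auto
  have "bounded (range (\<lambda>k. v (u k)))" using vu by (auto simp: bounded_iff)
  then obtain w r where r: "strict_mono r" "((\<lambda>k. v (u k)) \<circ> r) \<longlonglongrightarrow> w"
    using bounded_imp_convergent_subsequence by blast
  have w: "w \<in> V" "norm w \<le> \<epsilon>" "e \<le> norm w"
  proof -
    show "w \<in> V"
      using vu by (intro closed_sequentially[OF closed_subspace[OF subspace_V] _ r(2)]) auto
    show "norm w \<le> \<epsilon>"
      using vu by (intro LIMSEQ_le_const2[OF tendsto_norm[OF r(2)]]) auto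
    show "e \<le> norm w"
      using u by (intro LIMSEQ_le_const[OF tendsto_norm[OF r(2)]]) auto
  qed
  have "(\<lambda>k. norm (u k)) \<longlonglongrightarrow> 0"
    by (rule tendsto_sandwich[OF _ _ tendsto_const LIMSEQ_inverse_real_of_nat])
       (use u(2) in \<open>auto intro!: always_eventually\<close>)
  then have "u \<longlonglongrightarrow> 0" by (rule tendsto_norm_zero_cancel)
  then have "(u \<circ> r) \<longlonglongrightarrow> 0" using r(1) by (rule LIMSEQ_subseq_LIMSEQ)
  from tendsto_add[OF tendsto_add[OF tendsto_const[of xbar] this] r(2)]
  have lim: "(\<lambda>k. xbar + u (r k) + v (u (r k))) \<longlonglongrightarrow> xbar + w" by simp
  have "f (xbar + w) \<le> f xbar"
  proof (rule ccontr)
    assume "\<not> ?thesis"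
    \<comment> \<open>A level strictly between the two values gives the contradiction: lower
      semicontinuity keeps f above \<open>a\<close> along the sequence, while the upper estimate
      eventually drops below \<open>a\<close>.\<close>
    then obtain a where a: "f xbar < a" "a < f (xbar + w)" using dense not_le by metis
    have "a < Liminf (nhds (xbar + w)) f"
      using a(2) lsc unfolding lsc_fun_def by (metis order.strict_trans2)
    then have "\<forall>\<^sub>F y in nhds (xbar + w). a < f y" by (rule less_LiminfD)
    then have "\<forall>\<^sub>F k in sequentially. a < f (xbar + u (r k) + v (u (r k)))"
      using lim by (rule eventually_compose_filterlim)
    moreover have "\<forall>\<^sub>F k in sequentially. f xbar + ereal (inverse (real (Suc (r k)))) < a"
    proof -
      have "(\<lambda>k. f xbar + ereal (inverse (real (Suc (r k))))) \<longlonglongrightarrow> f xbar + ereal 0"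
        using fin_xbar LIMSEQ_subseq_LIMSEQ[OF LIMSEQ_inverse_real_of_nat r(1)]
        by (intro tendsto_add_ereal_general) (auto simp: comp_def)
      then show ?thesis using a(1) by (intro order_tendstoD(2)) auto
    qed
    ultimately have "\<forall>\<^sub>F k in sequentially. False"
    proof eventually_elim
      case (elim k)
      then show ?case using u(4)[of "r k"] by (meson leD order.strict_trans)
    qed
    then show False by simp
  qed
  then have "w = 0"
    using v_argmin(4)[of 0 w] w eps_pos subspace_U v_zero by (simp add: subspace_0)
  then show False using w assms by simp
qed

lemma valley_subgradients:
  obtains \<delta> where "\<delta> > 0" "\<delta> \<le> \<epsilon>"
    "\<And>u. u \<in> U \<Longrightarrow> norm u \<le> \<delta> \<Longrightarrow> norm (v u) + \<delta> \<le> \<epsilon>"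
    "\<And>u. u \<in> U \<Longrightarrow> norm u \<le> \<delta> \<Longrightarrow> f (xbar + u + v u) = ereal (l u)"
    "\<And>u. u \<in> U \<Longrightarrow> norm u \<le> \<delta> \<Longrightarrow> subgrads U \<delta> 1 l u \<noteq> {}"
proof -
  obtain \<delta>1 where "\<delta>1 > 0" and \<delta>1:
    "\<And>u. u \<in> U \<Longrightarrow> norm u \<le> \<delta>1 \<Longrightarrow> \<exists>z\<in>U. \<exists>y. norm z \<le> 1 \<and> y - u \<in> V \<and> tilt_min z y"
    by (rule tilts_onto[OF zero_less_one]) (rule that)
  obtain \<delta>2 where "\<delta>2 > 0" and \<delta>2: "\<And>u. u \<in> U \<Longrightarrow> norm u \<le> \<delta>2 \<Longrightarrow> norm (v u) < \<epsilon> / 2"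
    using valley_continuous[of "\<epsilon> / 2"] eps_pos by auto
  \<comment> \<open>Half of \<epsilon> goes to \<open>v u\<close> and half to \<open>u\<close>. Thus
    \<open>u + v u\<close> stays in the \<epsilon>-ball, and \<open>v u\<close> can later be moved
    within \<open>V\<close> by up to \<delta>.\<close>
  define \<delta> where "\<delta> = min (min \<delta>1 \<delta>2) (\<epsilon> / 2)"
  have \<delta>: "\<delta> > 0" "\<delta> \<le> \<delta>1" "\<delta> \<le> \<delta>2" "\<delta> \<le> \<epsilon> / 2"
    using \<open>\<delta>1 > 0\<close> \<open>\<delta>2 > 0\<close> eps_pos by (auto simp: \<delta>_def)
  have small: "norm u \<le> \<epsilon>" "norm (v u) < \<epsilon> / 2" "norm (u + v u) \<le> \<epsilon>" "v u \<in> V"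
    if "u \<in> U" "norm u \<le> \<delta>" for u
    using that \<delta> eps_pos \<delta>2[of u] norm_triangle_ineq[of u "v u"] v_argmin(1)[of u] by auto
  \<comment> \<open>The tilted minimiser \<open>y\<close> over \<open>u\<close> and the valley point
    \<open>u + v u\<close> differ by an element of \<open>V\<close>, on which the tilt
    \<open>z\<close> vanishes. As the valley point is no higher, uniqueness identifies the two, and
    \<open>z\<close> becomes a subgradient of f there.\<close>
  have key: "\<bar>f (xbar + u + v u)\<bar> \<noteq> \<infinity> \<and> (\<exists>z\<in>U. norm z \<le> 1 \<and>
      (\<forall>x. norm x \<le> \<epsilon> \<longrightarrow> f (xbar + u + v u) + ereal (z \<bullet> (x - (u + v u))) \<le> f (xbar + x)))"
    if u: "u \<in> U" "norm u \<le> \<delta>" for u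
  proof -
    have "norm u \<le> \<delta>1" using u \<delta> by simp
    then obtain z y where z: "z \<in> U" "norm z \<le> 1" and y0: "y - u \<in> V"
      and zy: "tilt_min z y"
      using \<delta>1[OF u(1)] by auto
    note sub = tilt_minD(3)[OF zy] and uni = tilt_minD(4)[OF zy]
      and y = y0 tilt_minD(1,2)[OF zy]
    have "norm (y - u) \<le> \<epsilon>" using UV_norm_le(2)[OF u(1) y(1)] y(2) by simp
    then have "f (xbar + u + v u) \<le> f (xbar + y)"
      using v_argmin(3)[of u "y - u"] u y small[OF u] by simp
    moreover have "z \<bullet> (u + v u - y) = 0"
      using U_perp_V[OF z(1) y0] U_perp_V[OF z(1) small(4)[OF u]]
      by (simp add: inner_diff_right inner_add_right)
    ultimately have "u + v u = y"
      using small[OF u] by (intro uni) (auto simp: add.assoc)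
    then show ?thesis using z y sub by (auto simp: add.assoc)
  qed
  have l: "f (xbar + u + v u) = ereal (l u)" if "u \<in> U" "norm u \<le> \<delta>" for u
    using key[OF that] by (auto simp: l_def ereal_real)
  show ?thesis
  proof (rule that[OF \<delta>(1) _ _ l])
    show "\<delta> \<le> \<epsilon>" using \<delta> eps_pos by simp
    fix u assume u: "u \<in> U" "norm u \<le> \<delta>"
    show "norm (v u) + \<delta> \<le> \<epsilon>" using small[OF u] \<delta> by simp
    obtain z where z: "z \<in> U" "norm z \<le> 1"
      and sub: "\<And>x. norm x \<le> \<epsilon> \<Longrightarrow> f (xbar + u + v u) + ereal (z \<bullet> (x - (u + v u))) \<le> f (xbar + x)"
      using key[OF u] by blast
    have "l u + z \<bullet> (w - u) \<le> l w" if w: "w \<in> U" "norm w \<le> \<delta>" for w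
    proof -
      have "z \<bullet> (w + v w - (u + v u)) = z \<bullet> (w - u)"
        using U_perp_V[OF z(1)] small[OF u] small[OF w] by (simp add: algebra_simps)
      then show ?thesis
        using sub[of "w + v w"] small[OF w] l[OF u] l[OF w] by (simp add: add.assoc[symmetric])
    qed
    then show "subgrads U \<delta> 1 l u \<noteq> {}" using z by (auto simp: subgrads_def)
  qed
qed

lemma valley_le:
  assumes "a \<in> U" "norm a \<le> \<epsilon>" "f (xbar + a + v a) = ereal (l a)" "w \<in> V" "norm w \<le> \<epsilon>"
  shows "ereal (l a) \<le> f (xbar + a + w)"
  using v_argmin(3)[OF assms(1,2,4,5)] assms(3) by simp

text \<open>Limiting subjets require convergence of the function values too. Minimality of
  \<open>xbar\<close> bounds the values from below, \<open>valley_usc\<close> from above.\<close>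

lemma valley_converges:
  assumes U: "\<And>k. u k \<in> U" and lim: "u \<longlonglongrightarrow> 0"
  shows "converges_wrt f (\<lambda>k. xbar + u k + v (u k)) xbar"
proof -
  have ev: "\<forall>\<^sub>F k in sequentially. norm (u k) \<le> d" if "d > 0" for d
    using order_tendstoD(2)[OF tendsto_norm_zero[OF lim] that] by (rule eventually_mono) simp
  have "(\<lambda>k. v (u k)) \<longlonglongrightarrow> 0"
  proof (rule tendstoI)
    fix e :: real assume "e > 0"
    then obtain d where d: "d > 0" "\<forall>a\<in>U. norm a \<le> d \<longrightarrow> norm (v a) < e"
      using valley_continuous by blast
    show "\<forall>\<^sub>F k in sequentially. dist (v (u k)) 0 < e"
      using ev[OF d(1)] by eventually_elim (use d U in simp)
  qed
  from tendsto_add[OF lim this] have uv: "(\<lambda>k. u k + v (u k)) \<longlonglongrightarrow> 0" by simp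
  from tendsto_add[OF tendsto_const[of xbar] this]
  have "(\<lambda>k. xbar + u k + v (u k)) \<longlonglongrightarrow> xbar" by (simp add: add.assoc)
  moreover have "(\<lambda>k. f (xbar + u k + v (u k))) \<longlonglongrightarrow> f xbar"
  proof (rule order_tendstoI)
    fix a assume a: "a < f xbar"
    have "\<forall>\<^sub>F k in sequentially. norm (u k + v (u k)) < \<epsilon>"
      by (rule order_tendstoD(2)[OF tendsto_norm_zero[OF uv] eps_pos])
    then show "\<forall>\<^sub>F k in sequentially. a < f (xbar + u k + v (u k))"
    proof eventually_elim
      case (elim k)
      then have "f xbar \<le> f (xbar + (u k + v (u k)))" by (intro xbar_min) simp
      with a show ?case by (simp add: add.assoc)
    qed
  next
    fix a assume "f xbar < a"
    then obtain b where b: "f xbar < ereal b" "ereal b < a" using ereal_dense2 by blast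
    obtain t where t: "f xbar = ereal t" using fin_xbar by (cases "f xbar") auto
    obtain d where d: "d > 0" "\<forall>a\<in>U. norm a \<le> d \<longrightarrow> f (xbar + a + v a) \<le> f xbar + ereal (b - t)"
      using valley_usc[of "b - t"] b t by auto
    show "\<forall>\<^sub>F k in sequentially. f (xbar + u k + v (u k)) < a"
      using ev[OF d(1)]
    proof eventually_elim
      case (elim k)
      then have "f (xbar + u k + v (u k)) \<le> ereal b" using d(2) U t by auto
      then show ?case using b(2) by (rule order.strict_trans1)
    qed
  qed
  ultimately show ?thesis by (simp add: converges_wrt_def)
qed

section \<open>Uniqueness of the subgradient of l near 0\<close>

text \<open>On each fibre over \<open>a\<close> in \<open>U\<close>, f is at least
  \<open>l a\<close>, and \<open>z\<close> vanishes on \<open>V\<close>. So a subgradient of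
  \<open>l\<close> at 0 is one of f at \<open>xbar\<close>, and lies in \<open>U\<close>.\<close>

lemma subgrads_zero:
  assumes \<delta>: "\<delta> > 0" "\<delta> \<le> \<epsilon>" and l: "\<And>a. a \<in> U \<Longrightarrow> norm a \<le> \<delta> \<Longrightarrow> f (xbar + a + v a) = ereal (l a)"
    and z: "z \<in> subgrads U \<delta> B l 0"
  shows "z = 0"
proof (rule subgrad_in_U_zero)
  show "z \<in> U" using z by (simp add: subgrads_def)
  have "\<forall>\<^sub>F y in nhds xbar. dist y xbar < \<delta>"
    using \<delta> by (auto simp: eventually_nhds_metric)
  then show "\<forall>\<^sub>F y in nhds xbar. f xbar + ereal (z \<bullet> (y - xbar)) \<le> f y"
  proof eventually_elim
    case (elim y)
    obtain a w where aw: "a \<in> U" "w \<in> V" "y - xbar = a + w" by (rule UV_decomp)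
    then have n: "norm a \<le> \<delta>" "norm w \<le> \<epsilon>"
      using UV_norm_le[OF aw(1,2)] elim \<delta> by (auto simp: dist_norm)
    have "f xbar + ereal (z \<bullet> (y - xbar)) = ereal (l 0 + z \<bullet> a)"
      using l[of 0] \<delta> subspace_U v_zero U_perp_V[OF \<open>z \<in> U\<close> aw(2)] aw(3)
      by (simp add: subspace_0 inner_add_right)
    also have "\<dots> \<le> ereal (l a)"
      using z aw(1) n by (auto simp: subgrads_def)
    also have "\<dots> \<le> f (xbar + a + w)"
      using aw n \<delta> by (intro valley_le l) auto
    also have "xbar + a + w = y" using aw(3) by (simp add: algebra_simps)
    finally show ?case .
  qed
qed

text \<open>The larger of \<open>a \<bullet> d\<close> and \<open>b \<bullet> d\<close> equals their
  mean plus half their distance. Two subgradients therefore give a kink with central slope (a + b)/2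
  and strength \<open>norm (b - a) / 2\<close> in direction \<open>h\<close>; f inherits it from
  \<open>l\<close> because f lies above \<open>l\<close> on the fibres.\<close>

lemma two_subgrads_mem_subjet:
  assumes l: "\<And>a. a \<in> U \<Longrightarrow> norm a \<le> \<delta> \<Longrightarrow> f (xbar + a + v a) = ereal (l a)"
    and u: "u \<in> U" "norm u < \<delta>" "norm (v u) + \<delta> \<le> \<epsilon>"
    and ab: "a \<in> subgrads U \<delta> B l u" "b \<in> subgrads U \<delta> B l u" "a \<noteq> b" and "K > 0"
  defines "h \<equiv> sgn (b - a)"
  shows "((1 / 2) *\<^sub>R (a + b), \<chi> i. (K * h $ i) *\<^sub>R h) \<in> subjet UNIV f (xbar + u + v u)"
proof (rule kink_mem_subjet)
  let ?x = "xbar + u + v u"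
  have \<delta>\<epsilon>: "\<delta> \<le> \<epsilon>" using u(3) by (meson norm_ge_zero add_increasing order_trans order_refl)
  have abU: "a \<in> U" "b \<in> U" using ab by (auto simp: subgrads_def)
  have vu: "v u \<in> V" using v_argmin(1)[of u] u \<delta>\<epsilon> by simp
  have fx: "f ?x = ereal (l u)" using l[of u] u by simp
  then show "\<bar>f ?x\<bar> \<noteq> \<infinity>" by simp
  show "norm (b - a) / 2 > 0" using ab by simp
  \<comment> \<open>In this radius the \<open>U\<close>-part stays in the \<delta>-ball, where
    \<open>a\<close> and \<open>b\<close> are subgradients, and the \<open>V\<close>-part stays in
    the \<epsilon>-ball because \<open>norm (v u) + \<delta> \<le> \<epsilon>\<close>.\<close>
  have "\<forall>\<^sub>F y in nhds ?x. dist y ?x < \<delta> - norm u"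
    using u by (auto simp: eventually_nhds_metric intro!: exI[of _ "\<delta> - norm u"])
  then show "\<forall>\<^sub>F y in nhds ?x. f ?x +
      ereal ((1 / 2) *\<^sub>R (a + b) \<bullet> (y - ?x) + norm (b - a) / 2 * \<bar>h \<bullet> (y - ?x)\<bar>) \<le> f y"
  proof eventually_elim
    case (elim y)
    obtain d w where dw: "d \<in> U" "w \<in> V" "y - ?x = d + w" by (rule UV_decomp)
    have "norm d \<le> norm (y - ?x)" "norm w \<le> norm (y - ?x)"
      using UV_norm_le[OF dw(1,2)] dw(3) by auto
    moreover have "norm (y - ?x) < \<delta> - norm u" using elim by (simp add: dist_norm)
    ultimately have n: "norm (u + d) \<le> \<delta>" "norm (v u + w) \<le> \<epsilon>"
      using norm_triangle_ineq[of u d] norm_triangle_ineq[of "v u" w] u norm_ge_zero[of u] by linarith+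
    have ud: "u + d \<in> U" using u dw subspace_U by (simp add: subspace_add)
    have a: "l u + a \<bullet> d \<le> l (u + d)" and b: "l u + b \<bullet> d \<le> l (u + d)"
      using subgradsD[OF ab(1) ud n(1)] subgradsD[OF ab(2) ud n(1)] by simp_all
    have "a \<bullet> (y - ?x) = a \<bullet> d" "b \<bullet> (y - ?x) = b \<bullet> d"
      using U_perp_V[OF _ dw(2)] abU by (auto simp: dw(3) inner_add_right)
    moreover have "norm (b - a) / 2 * \<bar>h \<bullet> (y - ?x)\<bar> = \<bar>(b - a) \<bullet> (y - ?x)\<bar> / 2"
      using ab(3) by (simp add: h_def sgn_div_norm abs_mult)
    ultimately have "(1 / 2) *\<^sub>R (a + b) \<bullet> (y - ?x) + norm (b - a) / 2 * \<bar>h \<bullet> (y - ?x)\<bar> =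
        (a \<bullet> d + b \<bullet> d) / 2 + \<bar>b \<bullet> d - a \<bullet> d\<bar> / 2"
      by (simp add: inner_add_left inner_diff_left)
    also have "\<dots> \<le> l (u + d) - l u" using a b by (auto simp: abs_if field_simps)
    finally have "f ?x + ereal ((1 / 2) *\<^sub>R (a + b) \<bullet> (y - ?x) + norm (b - a) / 2 * \<bar>h \<bullet> (y - ?x)\<bar>)
        \<le> ereal (l (u + d))"
      unfolding fx by simp
    also have "\<dots> \<le> f (xbar + (u + d) + (v u + w))"
      using ud n dw vu subspace_V \<delta>\<epsilon> by (intro valley_le l) (auto simp: subspace_add)
    also have "xbar + (u + d) + (v u + w) = y" using dw(3) by (simp add: algebra_simps)
    finally show ?case .
  qed
qed fact

lemma unique_subgrads:
  assumes \<delta>: "\<delta> > 0" and small: "\<And>a. a \<in> U \<Longrightarrow> norm a \<le> \<delta> \<Longrightarrow> norm (v a) + \<delta> \<le> \<epsilon>"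
    and l: "\<And>a. a \<in> U \<Longrightarrow> norm a \<le> \<delta> \<Longrightarrow> f (xbar + a + v a) = ereal (l a)"
    and ne: "\<And>a. a \<in> U \<Longrightarrow> norm a \<le> \<delta> \<Longrightarrow> subgrads U \<delta> B l a \<noteq> {}"
  shows "\<exists>\<delta>'>0. \<forall>u\<in>U. norm u \<le> \<delta>' \<longrightarrow> (\<exists>z. subgrads U \<delta> B l u = {z})"
proof (rule ccontr)
  assume no: "\<not> ?thesis"
  have 0: "0 \<in> U" using subspace_U by (rule subspace_0)
  have \<delta>\<epsilon>: "\<delta> \<le> \<epsilon>" using small[OF 0] \<delta> v_zero by simp
  have "\<exists>u a b. u \<in> U \<and> norm u < \<delta> \<and> norm u \<le> inverse (real (Suc k)) \<and>
      a \<in> subgrads U \<delta> B l u \<and> b \<in> subgrads U \<delta> B l u \<and> a \<noteq> b" for k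
  proof -
    have "min (\<delta> / 2) (inverse (real (Suc k))) > 0" using \<delta> by simp
    then obtain u where u: "u \<in> U" "norm u \<le> min (\<delta> / 2) (inverse (real (Suc k)))"
      "\<nexists>z. subgrads U \<delta> B l u = {z}"
      using no by blast
    then obtain a where "a \<in> subgrads U \<delta> B l u" using ne[of u] \<delta> by auto
    moreover from this u(3) obtain b where "b \<in> subgrads U \<delta> B l u" "a \<noteq> b" by blast
    ultimately show ?thesis using u \<delta> by (intro exI[of _ u] exI[of _ a] exI[of _ b]) auto
  qed
  then obtain u a b where u: "\<And>k. u k \<in> U" "\<And>k. norm (u k) < \<delta>" "\<And>k. norm (u k) \<le> inverse (real (Suc k))"
    and ab: "\<And>k. a k \<in> subgrads U \<delta> B l (u k)" "\<And>k. b k \<in> subgrads U \<delta> B l (u k)" "\<And>k. a k \<noteq> b k"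
    by metis
  have "(\<lambda>k. norm (u k)) \<longlonglongrightarrow> 0"
    by (rule tendsto_sandwich[OF _ _ tendsto_const LIMSEQ_inverse_real_of_nat])
       (use u(3) in \<open>auto intro!: always_eventually\<close>)
  then have u0: "u \<longlonglongrightarrow> 0" by (rule tendsto_norm_zero_cancel)
  define h where "h k = sgn (b k - a k)" for k
  have nh: "norm (h k) = 1" for k using ab(3)[of k] by (simp add: h_def norm_sgn)
  have hU: "h k \<in> U" for k
    using ab(1,2)[of k] subspace_U
    by (simp add: h_def sgn_div_norm subgrads_def subspace_diff subspace_scale)
  \<comment> \<open>Working with triples yields one subsequence along which both subgradients and
    the unit directions converge.\<close>
  have "bounded (range a \<times> range b \<times> range h)"
    using nh by (intro bounded_Times subgrads_bounded[OF ab(1)] subgrads_bounded[OF ab(2)])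
       (auto simp: bounded_iff)
  then have "bounded (range (\<lambda>k. (a k, b k, h k)))"
    by (rule bounded_subset) auto
  then obtain p r where r: "strict_mono r" and p: "((\<lambda>k. (a k, b k, h k)) \<circ> r) \<longlonglongrightarrow> p"
    using bounded_imp_convergent_subsequence by blast
  have alim: "(\<lambda>k. a (r k)) \<longlonglongrightarrow> fst p" and blim: "(\<lambda>k. b (r k)) \<longlonglongrightarrow> fst (snd p)"
    and hlim: "(\<lambda>k. h (r k)) \<longlonglongrightarrow> snd (snd p)"
    using tendsto_fst[OF p] tendsto_fst[OF tendsto_snd[OF p]] tendsto_snd[OF tendsto_snd[OF p]]
    by (simp_all add: comp_def)
  define g where "g = snd (snd p)"
  have ur: "(\<lambda>k. u (r k)) \<longlonglongrightarrow> 0" using LIMSEQ_subseq_LIMSEQ[OF u0 r] by (simp add: comp_def)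
  have ub: "u (r k) \<in> U \<inter> cball 0 \<delta>" for k using u(1,2)[of "r k"] by simp
  \<comment> \<open>Limits of the subgradients are subgradients of \<open>l\<close> at 0, hence
    zero; so the central slopes tend to 0, as needed for subhessians at the slope 0.\<close>
  have "fst p = 0"
    using subgrads_limit[OF closed_U ub ur ab(1) alim] ne[OF 0] \<delta>
    by (intro subgrads_zero[OF \<delta> \<delta>\<epsilon> l]) auto
  moreover have "fst (snd p) = 0"
    using subgrads_limit[OF closed_U ub ur ab(2) blim] ne[OF 0] \<delta>
    by (intro subgrads_zero[OF \<delta> \<delta>\<epsilon> l]) auto
  ultimately have mid: "(\<lambda>k. (1 / 2) *\<^sub>R (a (r k) + b (r k))) \<longlonglongrightarrow> 0"
    using tendsto_scaleR[OF tendsto_const[of "1 / 2"] tendsto_add[OF alim blim]] by simp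
  have g: "norm g = 1"
    using LIMSEQ_unique[OF tendsto_norm[OF hlim], of 1] nh by (simp add: g_def)
  have gU: "g \<in> U"
    using closed_sequentially[OF closed_U hU hlim] by (simp add: g_def)
  \<comment> \<open>The kinks shrink along the sequence, but for fixed \<open>K\<close> each of them
    still admits the curvature \<open>K\<close>. The limit K g g^T is thus a limiting subhessian for
    every \<open>K\<close>, which makes the support infinite at the unit vector \<open>g\<close> of
    \<open>U\<close>.\<close>
  have "ereal K \<le> rank1_support (lim_subhess f xbar 0) g" if K: "K > 0" for K
  proof -
    define Q :: "real^'n^'n" where "Q = (\<chi> i. (K * g $ i) *\<^sub>R g)"
    have "(0, Q) \<in> lim_subjet f xbar"
      unfolding lim_subjet_def mem_Collect_eq case_prod_conv
    proof (intro exI conjI allI)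
      show "converges_wrt f (\<lambda>k. xbar + u (r k) + v (u (r k))) xbar"
        using u(1) ur by (rule valley_converges)
      show "((1 / 2) *\<^sub>R (a (r k) + b (r k)), \<chi> i. (K * h (r k) $ i) *\<^sub>R h (r k))
          \<in> subjet UNIV f (xbar + u (r k) + v (u (r k)))" for k
        unfolding h_def using u ab K small[OF u(1) less_imp_le[OF u(2)]]
        by (intro two_subgrads_mem_subjet[OF l]) auto
      show "(\<lambda>k. \<chi> i. (K * h (r k) $ i) *\<^sub>R h (r k)) \<longlonglongrightarrow> Q"
        unfolding Q_def g_def by (intro tendsto_intros hlim)
    qed (rule mid)
    moreover have "transpose Q = Q" by (simp add: Q_def transpose_def vec_eq_iff)
    ultimately have "Q \<in> lim_subhess f xbar 0" by (simp add: lim_subhess_def)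
    moreover have "(Q *v g) \<bullet> g = K"
    proof -
      have "g \<bullet> g = 1" using g by (simp add: norm_eq_1)
      moreover have "Q *v g = (K * (g \<bullet> g)) *\<^sub>R g"
        by (simp add: Q_def vec_eq_iff matrix_vector_mul_component)
      ultimately show ?thesis by simp
    qed
    ultimately show ?thesis unfolding rank1_support_def by (metis SUP_upper)
  qed
  then have "rank1_support (lim_subhess f xbar 0) g = \<infinity>"
    by (intro ereal_top) (meson ereal_less_eq(3) gt_ex le_cases less_le_trans order_trans zero_less_one)
  then show False using gU dom_U by (auto simp: dom_rank1_support_def)
qed

section \<open>The U-Lagrangian and the lower Taylor estimate\<close>

lemma orth_proj_V_zero: "orth_proj V 0 = 0"
  unfolding orth_proj_def
proof (rule the_equality)
  show "0 \<in> V \<and> 0 - 0 \<in> V\<^sup>\<bottom>"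
    using subspace_0[OF subspace_V] subspace_0[OF subspace_U] U_comp by simp
  show "y = 0" if "y \<in> V \<and> 0 - y \<in> V\<^sup>\<bottom>" for y
    using that U_perp_V[of "0 - y" y] by (simp add: U_comp)
qed

lemma U_Lagrangian_eq:
  assumes "u \<in> U" "norm u \<le> \<epsilon>"
  shows "U_Lagrangian f xbar 0 \<epsilon> u = f (xbar + u + v u)"
proof -
  have "(INF w \<in> V \<inter> cball 0 \<epsilon>. f (xbar + u + w)) = f (xbar + u + v u)"
    using v_argmin[OF assms] by (intro INF_eqI) auto
  then show ?thesis
    using assms by (simp add: U_Lagrangian_def orth_proj_V_zero flip: U_eq V_eq zero_ereal_def)
qed

text \<open>Since f is at least \<open>l u'\<close> on the fibre over \<open>u'\<close> and the
  gradient of \<open>l\<close> is orthogonal to \<open>V\<close>, the estimate reduces to one for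
  \<open>l\<close> alone.\<close>

lemma lower_taylor:
  "\<exists>\<delta>>0. \<forall>u \<in> cball 0 \<delta> \<inter> U.
     \<exists>zU. has_gradient_on U (U_Lagrangian f xbar 0 \<epsilon>) zU u \<and>
       (\<forall>Q \<in> subhess U (U_Lagrangian f xbar 0 \<epsilon>) u zU.
          \<exists>r :: real^'n \<Rightarrow> real.
            r 0 = 0 \<and> r \<in> o[at 0 within U](\<lambda>w. (norm w)\<^sup>2) \<and>
            (\<forall>u' \<in> U. \<forall>v' \<in> V. u' + v' \<in> cball (u + v u) \<delta> \<longrightarrow>
               f (xbar + u' + v') \<ge> f (xbar + u + v u)
                 + ereal (zU \<bullet> (u' + v' - (u + v u))
                          + 1 / 2 * ((u' - u) \<bullet> (Q *v (u' - u)))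
                          + r (u' - u))))"
proof -
  let ?L = "U_Lagrangian f xbar 0 \<epsilon>"
  obtain \<delta>0 where \<delta>0: "\<delta>0 > 0" "\<delta>0 \<le> \<epsilon>"
    and small: "\<And>u. u \<in> U \<Longrightarrow> norm u \<le> \<delta>0 \<Longrightarrow> norm (v u) + \<delta>0 \<le> \<epsilon>"
    and l: "\<And>u. u \<in> U \<Longrightarrow> norm u \<le> \<delta>0 \<Longrightarrow> f (xbar + u + v u) = ereal (l u)"
    and ne: "\<And>u. u \<in> U \<Longrightarrow> norm u \<le> \<delta>0 \<Longrightarrow> subgrads U \<delta>0 1 l u \<noteq> {}"
    by (rule valley_subgradients) (rule that)
  obtain \<delta>1 where \<delta>1: "\<delta>1 > 0"
    and uniq: "\<And>u. u \<in> U \<Longrightarrow> norm u \<le> \<delta>1 \<Longrightarrow> \<exists>z. subgrads U \<delta>0 1 l u = {z}"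
    using unique_subgrads[OF \<delta>0(1) small l ne] by blast
  \<comment> \<open>Both \<open>u\<close> and \<open>u' - u\<close> have norm at most \<delta>, so
    halving keeps \<open>u'\<close> in the ball of radius \<delta>0.\<close>
  define \<delta> where "\<delta> = min \<delta>1 (\<delta>0 / 2)"
  have \<delta>: "\<delta> > 0" "\<delta> \<le> \<delta>1" "2 * \<delta> \<le> \<delta>0" using \<delta>0 \<delta>1 by (auto simp: \<delta>_def)
  have L: "?L u = ereal (l u)" if "u \<in> U" "norm u \<le> \<delta>0" for u
    using U_Lagrangian_eq[of u] l[of u] that \<delta>0 by simp
  show ?thesis
  proof (intro exI[of _ \<delta>] conjI ballI \<delta>(1))
    fix u assume "u \<in> cball 0 \<delta> \<inter> U"
    then have u: "u \<in> U" "norm u \<le> \<delta>" by auto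
    then have u0: "norm u < \<delta>0" using \<delta> by simp
    obtain z where z: "subgrads U \<delta>0 1 l u = {z}" using uniq u \<delta> by fastforce
    then have "z \<in> U" by (auto simp: subgrads_def)
    have der: "(l has_derivative (\<lambda>h. z \<bullet> h)) (at u within U)"
      using ne by (intro unique_subgrad_has_derivative[OF closed_U u(1) u0 _ z]) auto
    have near: "norm y \<le> \<delta>0" if "dist y u < \<delta>0 - norm u" for y
      using that norm_triangle_sub[of y u] by (simp add: dist_norm)
    have ev: "\<forall>\<^sub>F y in at u within U. y \<in> U \<and> norm y \<le> \<delta>0"
      using u0 near by (auto simp: eventually_at intro!: exI[of _ "\<delta>0 - norm u"])
    have grad: "has_gradient_on U ?L z u"
      unfolding has_gradient_on_def
    proof (intro conjI)
      show "\<bar>?L u\<bar> \<noteq> \<infinity>" using L[of u] u u0 by simp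
      show "\<forall>\<^sub>F y in at u within U. \<bar>?L y\<bar> \<noteq> \<infinity>"
        using ev by eventually_elim (simp add: L)
      show "((\<lambda>y. real_of_ereal (?L y)) has_derivative (\<lambda>h. z \<bullet> h)) (at u within U)"
      proof (rule has_derivative_transform_within[OF der])
        show "\<delta>0 - norm u > 0" using u0 by simp
        show "l y = real_of_ereal (?L y)" if "y \<in> U" "dist y u < \<delta>0 - norm u" for y
          using L[OF that(1) near[OF that(2)]] by simp
      qed (rule u)
    qed fact+
    moreover have "\<exists>r :: real^'n \<Rightarrow> real.
            r 0 = 0 \<and> r \<in> o[at 0 within U](\<lambda>w. (norm w)\<^sup>2) \<and>
            (\<forall>u' \<in> U. \<forall>v' \<in> V. u' + v' \<in> cball (u + v u) \<delta> \<longrightarrow>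
               f (xbar + u' + v') \<ge> f (xbar + u + v u)
                 + ereal (z \<bullet> (u' + v' - (u + v u))
                          + 1 / 2 * ((u' - u) \<bullet> (Q *v (u' - u)))
                          + r (u' - u)))"
      if Q: "Q \<in> subhess U ?L u z" for Q
    proof -
      obtain \<psi> G H where C2: "C2_on U \<psi> G H" and zQ: "z = G u" "Q = H u"
        and loc: "\<forall>\<^sub>F y in at u within U. ?L u - ereal (\<psi> u) \<le> ?L y - ereal (\<psi> y)"
        using Q by (auto simp: subhess_def subjet_def)
      \<comment> \<open>Truncating at 0 makes the inequality for \<open>l\<close> hold for every
        \<open>w\<close>. It remains to bound the negative part: near \<open>u\<close> the
        increments of \<open>l\<close> dominate those of the test function \<psi>, whose expansion
        has gradient \<open>z\<close> and Hessian \<open>Q\<close>.\<close>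
      define r where "r w = min 0 (l (u + w) - l u - z \<bullet> w - 1 / 2 * (w \<bullet> (Q *v w)))" for w
      have "r \<in> o[at 0 within U](\<lambda>w. (norm w)\<^sup>2)"
      proof (rule landau_o.smallI)
        fix c :: real assume "c > 0"
        have "\<forall>\<^sub>F y in at u within U. \<psi> y - \<psi> u \<le> l y - l u"
          using loc ev by eventually_elim (use L u u0 in auto)
        then obtain d where d: "d > 0"
          "\<And>y. y \<in> U \<Longrightarrow> y \<noteq> u \<Longrightarrow> dist y u < d \<Longrightarrow> \<psi> y - \<psi> u \<le> l y - l u"
          by (auto simp: eventually_at)
        have "\<forall>\<^sub>F w in at 0 within U. \<psi> (u + w) - \<psi> u \<le> l (u + w) - l u"
          unfolding eventually_at
          using d subspace_add[OF subspace_U u(1)]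
          by (intro exI[of _ d]) (auto simp: dist_norm)
        then show "\<forall>\<^sub>F w in at 0 within U. norm (r w) \<le> c * norm ((norm w)\<^sup>2)"
          using C2_on_taylor[OF subspace_U C2 u(1) \<open>c > 0\<close>]
        proof eventually_elim
          case (elim w)
          then show ?case by (auto simp: r_def zQ min_def)
        qed
      qed
      moreover have "f (xbar + u' + v') \<ge> f (xbar + u + v u)
           + ereal (z \<bullet> (u' + v' - (u + v u)) + 1 / 2 * ((u' - u) \<bullet> (Q *v (u' - u))) + r (u' - u))"
        if w: "u' \<in> U" "v' \<in> V" "u' + v' \<in> cball (u + v u) \<delta>" for u' v'
      proof -
        have vu: "v u \<in> V" using v_argmin(1)[of u] u u0 \<delta>0 by simp
        have dU: "u' - u \<in> U" and dV: "v' - v u \<in> V"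
          using w u vu subspace_U subspace_V by (auto simp: subspace_diff)
        have split: "u' + v' - (u + v u) = (u' - u) + (v' - v u)" by simp
        have "norm (u' + v' - (u + v u)) \<le> \<delta>"
          using w(3) by (simp add: dist_norm norm_minus_commute)
        then have "norm (u' - u) \<le> \<delta>" "norm (v' - v u) \<le> \<delta>"
          using UV_norm_le[OF dU dV] unfolding split by auto
        then have "norm u' \<le> \<delta>0" "norm v' \<le> \<epsilon>"
          using norm_triangle_sub[of u' u] norm_triangle_sub[of v' "v u"] u u0 \<delta> small[of u] by auto
        then have "ereal (l u') \<le> f (xbar + u' + v')"
          using w \<delta>0 by (intro valley_le l) auto
        moreover have "z \<bullet> (u' + v' - (u + v u)) = z \<bullet> (u' - u)"
          using U_perp_V[OF \<open>z \<in> U\<close> dV] unfolding split by (simp add: inner_add_right)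
        moreover have "l u + (z \<bullet> (u' - u) + 1 / 2 * ((u' - u) \<bullet> (Q *v (u' - u))) + r (u' - u)) \<le> l u'"
          by (simp add: r_def min_def)
        ultimately show ?thesis
          using l[of u] u u0 by (auto intro: order_trans[rotated])
      qed
      ultimately show ?thesis
        by (intro exI[of _ r]) (simp add: r_def)
    qed
    ultimately show "\<exists>zU. has_gradient_on U ?L zU u \<and>
       (\<forall>Q \<in> subhess U ?L u zU.
          \<exists>r :: real^'n \<Rightarrow> real.
            r 0 = 0 \<and> r \<in> o[at 0 within U](\<lambda>w. (norm w)\<^sup>2) \<and>
            (\<forall>u' \<in> U. \<forall>v' \<in> V. u' + v' \<in> cball (u + v u) \<delta> \<longrightarrow>
               f (xbar + u' + v') \<ge> f (xbar + u + v u)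
                 + ereal (zU \<bullet> (u' + v' - (u + v u))
                          + 1 / 2 * ((u' - u) \<bullet> (Q *v (u' - u)))
                          + r (u' - u))))"
      by blast
  qed
qed

end

theorem corollary54:
  fixes f :: "real^'n \<Rightarrow> ereal"
    and xbar zbar :: "real^'n"
    and U V :: "(real^'n) set"
    and \<epsilon> \<rho> :: real
    and v :: "real^'n \<Rightarrow> real^'n"
  assumes "proper_fun f" and "lsc_fun f"
    and "quadratically_minorised f xbar"
    and "zbar = 0"
    and "zbar \<in> lim_subdiff f xbar"
    and "prox_regular f xbar zbar"
    and U_def: "U = U_space f xbar zbar"
    and V_def: "V = V_space f xbar zbar"
    and "dom_rank1_support (lim_subhess f xbar 0) = U"
    and "subspace (dom_rank1_support (lim_subhess f xbar 0))"
    and "\<epsilon> > 0"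
    and "tilt_stable_min f xbar \<epsilon>"
    and "0 \<in> rel_interior (lim_subdiff f xbar)"
    and "\<forall>u \<in> U \<inter> cball 0 \<epsilon>.
           v u \<in> argmin_on (\<lambda>v'. co (localised f xbar zbar \<epsilon>) (u + v')) (V \<inter> cball 0 \<epsilon>)"
    and "\<forall>u \<in> U \<inter> cball 0 \<epsilon>. sing_subdiff f (xbar + u + v u) = {0}"
    and "0 < \<rho>" and "\<rho> \<le> \<epsilon>"
    and "cball 0 \<rho> \<inter> V \<subseteq> V_subdiff f xbar zbar"
    and "\<forall>zV \<in> cball 0 \<rho> \<inter> V. \<forall>u \<in> cball 0 \<epsilon> \<inter> U.
           {v u} = argmin_on (\<lambda>v'. f (xbar + u + v') - ereal (zV \<bullet> v')) (V \<inter> cball 0 \<epsilon>)"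
  shows "\<exists>\<delta>>0. \<forall>u \<in> cball 0 \<delta> \<inter> U.
           \<exists>zU. has_gradient_on U (U_Lagrangian f xbar zbar \<epsilon>) zU u \<and>
             (\<forall>Q \<in> subhess U (U_Lagrangian f xbar zbar \<epsilon>) u zU.
                \<exists>r :: real^'n \<Rightarrow> real.
                  r 0 = 0 \<and> r \<in> o[at 0 within U](\<lambda>w. (norm w)\<^sup>2) \<and>
                  (\<forall>u' \<in> U. \<forall>v' \<in> V. u' + v' \<in> cball (u + v u) \<delta> \<longrightarrow>
                     f (xbar + u' + v') \<ge> f (xbar + u + v u)
                       + ereal ((zU + orth_proj V zbar) \<bullet> (u' + v' - (u + v u))
                                + 1 / 2 * ((u' - u) \<bullet> (Q *v (u' - u)))
                                + r (u' - u))))"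
proof -
  interpret tilt_stable_valley f xbar U V \<epsilon> v
  proof
    show "f x \<noteq> -\<infinity>" for x using \<open>proper_fun f\<close> by (simp add: proper_fun_def)
    show "argmin_on (\<lambda>w. f (xbar + u + w)) (V \<inter> cball 0 \<epsilon>) = {v u}" if "u \<in> U" "norm u \<le> \<epsilon>" for u
    proof -
      \<comment> \<open>The tilt z_V = 0 is admissible, which makes \<open>v u\<close> the unique
        minimiser of the untilted function on the fibre.\<close>
      have "0 \<in> cball 0 \<rho> \<inter> V" using \<open>0 < \<rho>\<close> by (simp add: V_def V_space_def span_zero)
      then have "{v u} = argmin_on (\<lambda>w. f (xbar + u + w) - ereal (0 \<bullet> w)) (V \<inter> cball 0 \<epsilon>)"
        using assms(19)[rule_format, of 0 u] that by simp
      then show ?thesis by (simp flip: zero_ereal_def)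
    qed
  qed (use assms in simp_all)
  have "orth_proj V zbar = 0" using \<open>zbar = 0\<close> orth_proj_V_zero by simp
  then show ?thesis using lower_taylor \<open>zbar = 0\<close> by simp
qed

end
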